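(* For any coprime positive integers $m,n$ and any integer $k\ge1$, the symmetric function $$\frac{[k]_q}{[km]_q}\,e_{kn}\big[X[km]_q\big]$$ is a Schur positive symmetric polynomial, i.e. it equals $\sum_{\lambda\vdash kn}c_\lambda(q)\,s_\lambda[X]$ with every $c_\lambda(q)\in\mathbb{Z}_{\ge0}[q]$.
   Context: $[s]_q=1+q+\cdots+q^{s-1}$ for integers $s\ge0$. Plethystic notation: $e_{kn}[X[km]_q]$ denotes the elementary symmetric function $e_{kn}$ evaluated on the alphabet $\{q^jx_i:0\le j\le km-1,\ i\ge1\}$, where $X=x_1+x_2+\cdots$. *)

theory Defs
  imports
    "HOL-Library.Poly_Mapping"
    "HOL-Computational_Algebra.Computational_Algebra"
begin

text \<open>
  The variables \<open>x\<^sub>1, x\<^sub>2, \<dots>\<close> are indexed by \<^typ>\<open>nat\<close>, starting from 0.  A monomial is an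
  exponent vector of finite support, and a (possibly infinite) formal sum of monomials, such as
  a symmetric function, is the function giving the coefficient of each monomial.
\<close>

type_synonym monomial = "nat \<Rightarrow>\<^sub>0 nat"

type_synonym 'a symfun = "monomial \<Rightarrow> 'a"

text \<open>The coefficient field is \<open>\<rat>(q)\<close>, obtained as the fraction field of \<open>\<int>[q]\<close>.\<close>

type_synonym qfield = "int poly fract"

definition q :: qfield where
  "q = to_fract [:0, 1:]"

definition q_int :: "nat \<Rightarrow> qfield" where
  "q_int s = (\<Sum>i<s. q ^ i)"

text \<open>
  The elementary symmetric function \<open>e\<^sub>d\<close> evaluated on the alphabet \<open>{y a : a \<in> A}\<close> of polynomials
  in the \<open>x\<^sub>i\<close>: the sum of \<open>\<Prod>a\<in>S. y a\<close> over the \<open>d\<close>-element subsets \<open>S\<close> of the index set,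
  formed coefficient by coefficient.  As \<open>A\<close> may be infinite, the sum for a given monomial ranges
  over the \<open>S\<close> that contribute to it; for the alphabet \<open>X[s]\<^sub>q\<close> these are finite in number, see
  \<open>finite_elem_sym_qalphabet\<close>.
\<close>

definition elem_sym ::
    "nat \<Rightarrow> 'b set \<Rightarrow> ('b \<Rightarrow> (monomial \<Rightarrow>\<^sub>0 'a::comm_ring_1)) \<Rightarrow> 'a symfun" where
  "elem_sym d A y \<alpha> =
    (\<Sum>S | S \<subseteq> A \<and> finite S \<and> card S = d \<and> Poly_Mapping.lookup (\<Prod>a\<in>S. y a) \<alpha> \<noteq> 0.
       Poly_Mapping.lookup (\<Prod>a\<in>S. y a) \<alpha>)"

text \<open>The pair \<open>(i, j)\<close> indexes the letter \<open>q\<^sup>j x\<^sub>i\<close>.\<close>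

definition qletter :: "nat \<times> nat \<Rightarrow> (monomial \<Rightarrow>\<^sub>0 qfield)" where
  "qletter = (\<lambda>(i, j). Poly_Mapping.single (Poly_Mapping.single i 1) (q ^ j))"

text \<open>\<open>e\<^sub>d[X[s]\<^sub>q]\<close>\<close>

definition elem_sym_plethysm :: "nat \<Rightarrow> nat \<Rightarrow> qfield symfun" where
  "elem_sym_plethysm d s = elem_sym d (UNIV \<times> {..<s}) qletter"

definition partitions :: "nat \<Rightarrow> nat list set" where
  "partitions N = {\<mu>. sorted_wrt (\<ge>) \<mu> \<and> 0 \<notin> set \<mu> \<and> sum_list \<mu> = N}"

text \<open>Semistandard Young tableaux of shape \<open>\<mu>\<close>, as the list of their rows (English notation).\<close>

definition ssyt :: "nat list \<Rightarrow> nat list list set" where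
  "ssyt \<mu> = {T. map length T = \<mu> \<and> (\<forall>r \<in> set T. sorted r) \<and>
     (\<forall>i j. Suc i < length T \<and> j < length (T ! Suc i) \<longrightarrow> T ! i ! j < T ! Suc i ! j)}"

definition content :: "nat list list \<Rightarrow> monomial" where
  "content T = (\<Sum>i\<leftarrow>concat T. Poly_Mapping.single i 1)"

text \<open>\<open>s\<^sub>\<mu>\<close> is the sum of \<open>x\<^sup>T\<close> over all semistandard tableaux \<open>T\<close> of shape \<open>\<mu>\<close>.\<close>

definition schur :: "nat list \<Rightarrow> 'a::comm_ring_1 symfun" where
  "schur \<mu> \<alpha> = of_nat (card {T \<in> ssyt \<mu>. content T = \<alpha>})"

definition schur_positive :: "nat \<Rightarrow> qfield symfun \<Rightarrow> bool" where
  "schur_positive N f \<longleftrightarrow>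
    (\<exists>c :: nat list \<Rightarrow> int poly.
       (\<forall>\<mu> \<in> partitions N. \<forall>i. 0 \<le> coeff (c \<mu>) i) \<and>
       (\<forall>\<alpha>. f \<alpha> = (\<Sum>\<mu> \<in> partitions N. to_fract (c \<mu>) * schur \<mu> \<alpha>)))"

text \<open>The index sets of the three sums (resp. cardinalities) above are finite.\<close>

lemma finite_partitions: "finite (partitions N)"
proof -
  have "length \<mu> \<le> sum_list \<mu>" if "0 \<notin> set \<mu>" for \<mu> :: "nat list"
    using that by (induction \<mu>) auto
  moreover have "set \<mu> \<subseteq> {..sum_list \<mu>}" for \<mu> :: "nat list"
    using member_le_sum_list by auto
  ultimately have "partitions N \<subseteq> {\<mu>. set \<mu> \<subseteq> {..N} \<and> length \<mu> \<le> N}"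
    by (auto simp: partitions_def)
  thus ?thesis
    by (rule finite_subset) (rule finite_lists_length_le, simp)
qed

lemma prod_qletter:
  assumes "finite S"
  shows "(\<Prod>a\<in>S. qletter a) =
    Poly_Mapping.single (\<Sum>a\<in>S. Poly_Mapping.single (fst a) 1) (\<Prod>a\<in>S. q ^ snd a)"
  using assms by (induction S) (auto simp: qletter_def mult_single split: prod.splits)

lemma finite_elem_sym_qalphabet:
  "finite {S. S \<subseteq> UNIV \<times> {..<s} \<and> finite S \<and> card S = d \<and>
     Poly_Mapping.lookup (\<Prod>a\<in>S. qletter a) \<alpha> \<noteq> 0}" (is "finite ?F")
proof (rule finite_subset)
  show "?F \<subseteq> Pow (Poly_Mapping.keys \<alpha> \<times> {..<s})"
  proof clarify
    fix S i j
    assume S: "S \<subseteq> UNIV \<times> {..<s}" "finite S" and ij: "(i, j) \<in> S"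
      and nz: "Poly_Mapping.lookup (\<Prod>a\<in>S. qletter a) \<alpha> \<noteq> 0"
    from nz have "\<alpha> = (\<Sum>a\<in>S. Poly_Mapping.single (fst a) 1)"
      by (auto simp: prod_qletter[OF S(2)] lookup_single when_def split: if_splits)
    hence "Poly_Mapping.lookup \<alpha> i = (\<Sum>a\<in>S. Poly_Mapping.lookup (Poly_Mapping.single (fst a) 1) i)"
      by (simp add: lookup_sum)
    also have "\<dots> \<ge> Poly_Mapping.lookup (Poly_Mapping.single (fst (i, j)) (1::nat)) i"
      using ij S(2) by (intro member_le_sum) auto
    finally have "Poly_Mapping.lookup \<alpha> i \<noteq> 0" by simp
    thus "i \<in> Poly_Mapping.keys \<alpha> \<and> j \<in> {..<s}"
      using S(1) ij by (auto simp: in_keys_iff)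
  qed
qed auto

lemma finite_ssyt_content: "finite {T \<in> ssyt \<mu>. content T = \<alpha>}"
proof (rule finite_subset)
  have keys: "set xs \<subseteq> Poly_Mapping.keys (\<Sum>i\<leftarrow>xs. Poly_Mapping.single i (1::nat))" for xs
    by (induction xs) (auto simp: in_keys_iff lookup_add lookup_single when_def)
  show "{T \<in> ssyt \<mu>. content T = \<alpha>} \<subseteq>
    {T. set T \<subseteq> {r. set r \<subseteq> Poly_Mapping.keys \<alpha> \<and> length r \<le> sum_list \<mu>} \<and> length T = length \<mu>}"
    using keys[of "concat T" for T] member_le_sum_list
    by (fastforce simp: ssyt_def content_def)
  show "finite \<dots>"
    by (intro finite_lists_length_eq finite_lists_length_le) simp
qed

end

theory Submission
  imports Defs
begin

text \<open>
  Put \<open>M = km\<close> and \<open>N = kn\<close>, so that \<open>gcd M N = k\<close>.  By the dual Cauchy identity, the coefficient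
  of \<open>s\<^sub>\<mu>[X]\<close> is \<open>[k]/[M]\<close> times \<open>f = s\<^sub>\<mu>\<^sub>'(1, q, \<dots>, q\<^bsup>M-1\<^esup>)\<close>.

  It is a polynomial: \<open>f\<close> is an integer combination of products of the \<open>e\<^sub>a(1, \<dots>, q\<^bsup>M-1\<^esup>)\<close> of total
  degree \<open>N\<close>; since \<open>[M]\<close> divides \<open>[a] e\<^sub>a\<close>, the Euclidean algorithm on \<open>q\<close>-integers shows that \<open>[M]\<close>
  divides \<open>[gcd M N]\<close> times each such product.

  It is nonnegative: \<open>f\<close> is unimodal about \<open>(M - 1)N/2\<close>, and \<open>p (1 - q\<^bsup>M\<^esup>) = f (1 - q\<^bsup>k\<^esup>)\<close> with \<open>k \<le> M\<close>
  then forces the polynomial \<open>p\<close> to be nonnegative.  Unimodality holds because \<open>f\<close> is the graded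
  dimension of a representation of \<open>sl\<^sub>2\<close>, the restriction to the principal \<open>sl\<^sub>2\<close> of the \<open>gl\<^sub>M\<close>-module
  with a basis of Gelfand--Tsetlin patterns; the one nontrivial commutator is a sum of residues.
\<close>

section \<open>Weight spaces and divided differences\<close>

text \<open>Multiplying by (1 - q^k)/(1 - q^M) can turn nonnegative coefficients into negative ones
  even when the result is a polynomial: (1 + q^3)(1 - q)/(1 - q^2) = 1 - q + q^2. The rise and fall
  of f excludes this. The representation appears only as explicit matrices. A grading of the
  patterns and the relation [E, F] = H already force injectivity below the centre, so coefficients
  without square roots suffice. Their formulas have apparent poles where two shifted entries of a
  row differ by 1, and formally they allow moves that leave the set of patterns. In both situations
  interlacing makes a numerator vanish, and this is what permits the commutator to be summed as
  residues. The weights k (M - k) have second difference -2. Summation by parts therefore collapses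
  the diagonal terms to (M - 1) N minus twice the weight, and this places the centre of symmetry.
  Shapes of tableaux are recorded by column lengths, sequences with at most M nonzero entries, so
  that conjugation is absorbed into the indexing.\<close>

lemma homogeneous_system_nontrivial:
  fixes m :: "'a \<Rightarrow> 'b \<Rightarrow> 'f::field"
  assumes "finite B" "finite A" "card B < card A"
  shows "\<exists>v. (\<exists>a\<in>A. v a \<noteq> 0) \<and> (\<forall>b\<in>B. (\<Sum>a\<in>A. v a * m a b) = 0)"
  using assms
proof (induction B arbitrary: A m rule: finite_induct)
  case empty
  then have "A \<noteq> {}" by auto
  then show ?case by (intro exI[of _ "\<lambda>_. 1"]) auto
next
  case (insert b B)
  show ?case
  proof (cases "\<forall>a\<in>A. m a b = 0")
    case True
    have "card B < card A" using insert by simp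
    then obtain v where "\<exists>a\<in>A. v a \<noteq> 0" "\<forall>c\<in>B. (\<Sum>a\<in>A. v a * m a c) = 0"
      using insert.IH[OF insert.prems(1), of m] by blast
    with True show ?thesis by (intro exI[of _ v]) simp
  next
    case False
    then obtain a0 where a0: "a0 \<in> A" "m a0 b \<noteq> 0" by auto
    let ?A = "A - {a0}"
    have "card B < card ?A" using insert a0 by auto
    from insert.IH[OF _ this, of "\<lambda>a c. m a c - m a b / m a0 b * m a0 c"] insert.prems(1)
    obtain v where v: "\<exists>a\<in>?A. v a \<noteq> 0"
      and eq: "\<And>c. c \<in> B \<Longrightarrow> (\<Sum>a\<in>?A. v a * (m a c - m a b / m a0 b * m a0 c)) = 0" by auto
    \<comment> \<open>The value that equation \<open>b\<close> forces on the eliminated unknown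
      \<open>a0\<close>. Substituting it into the other equations produces the modified coefficients
      given to the induction hypothesis.\<close>
    define s where "s = - (\<Sum>a\<in>?A. v a * m a b) / m a0 b"
    have split: "(\<Sum>a\<in>A. (v(a0 := s)) a * m a c) = s * m a0 c + (\<Sum>a\<in>?A. v a * m a c)" for c
      using a0 insert.prems(1) by (simp add: sum.remove)
    have "s * m a0 c + (\<Sum>a\<in>?A. v a * m a c) = 0" if "c \<in> B" for c
      using eq[OF that] a0
      by (simp add: s_def sum_subtractf right_diff_distrib sum_distrib_right sum_divide_distrib mult.assoc)
    moreover have "s * m a0 b + (\<Sum>a\<in>?A. v a * m a b) = 0" using a0 by (simp add: s_def)
    ultimately have "\<forall>c\<in>insert b B. (\<Sum>a\<in>A. (v(a0 := s)) a * m a c) = 0"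
      unfolding split by blast
    moreover have "\<exists>a\<in>A. (v(a0 := s)) a \<noteq> 0" using v by auto
    ultimately show ?thesis by blast
  qed
qed

text \<open>Highest-weight argument for sl_2. If the weight space at \<open>i\<close> were larger
  than the next one, raising would kill a nonzero vector in it. Applying the raising operator to its
  repeated lowerings returns nonzero multiples of the previous ones, so none of them vanishes; but a
  finite set has a least weight. Vectors are rows: \<open>u x y\<close> is the coefficient of
  \<open>y\<close> in the image of \<open>x\<close>.\<close>

lemma weight_card_le:
  fixes u d :: "'a \<Rightarrow> 'a \<Rightarrow> real" and h :: "'a \<Rightarrow> int"
  assumes fin: "finite G"
    and u: "\<And>x y. x \<in> G \<Longrightarrow> y \<in> G \<Longrightarrow> u x y \<noteq> 0 \<Longrightarrow> h y = h x + 1"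
    and d: "\<And>x y. x \<in> G \<Longrightarrow> y \<in> G \<Longrightarrow> d x y \<noteq> 0 \<Longrightarrow> h x = h y + 1"
    and comm: "\<And>x y. x \<in> G \<Longrightarrow> y \<in> G \<Longrightarrow>
      (\<Sum>z\<in>G. u x z * d z y) - (\<Sum>z\<in>G. d x z * u z y) = (if x = y then of_int (D - 2 * h x) else 0)"
    and i: "2 * i < D"
  shows "card {x \<in> G. h x = i} \<le> card {x \<in> G. h x = i + 1}"
proof (rule ccontr)
  assume "\<not> ?thesis"
  hence lt: "card {x \<in> G. h x = i + 1} < card {x \<in> G. h x = i}" by simp
  obtain v0 where v0: "\<exists>a\<in>{x \<in> G. h x = i}. v0 a \<noteq> 0"
    "\<forall>b\<in>{x \<in> G. h x = i + 1}. (\<Sum>a\<in>{x \<in> G. h x = i}. v0 a * u a b) = 0"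
    using homogeneous_system_nontrivial[OF _ _ lt, of u] fin by auto
  define v where "v x = (if h x = i then v0 x else 0)" for x
  define U where "U w y = (\<Sum>x\<in>G. w x * u x y)" for w y
  define L where "L w y = (\<Sum>x\<in>G. w x * d x y)" for w y
  have Uv: "U v y = 0" if "y \<in> G" for y
  proof (cases "h y = i + 1")
    case True
    have "U v y = (\<Sum>a\<in>{x \<in> G. h x = i}. v0 a * u a y)"
      unfolding U_def v_def using fin by (intro sum.mono_neutral_cong_right) auto
    then show ?thesis using v0(2) that True by auto
  next
    case False
    then show ?thesis unfolding U_def v_def
      using u that by (intro sum.neutral) force
  qed
  have LU: "U (L w) y = L (U w) y - of_int (D - 2 * h y) * w y" if y: "y \<in> G" for w y
  proof -
    have "L (U w) y = (\<Sum>x\<in>G. w x * (\<Sum>z\<in>G. u x z * d z y))"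
      unfolding L_def U_def by (subst sum_distrib_right, subst sum.swap) (simp add: sum_distrib_left mult.assoc)
    moreover have "U (L w) y = (\<Sum>x\<in>G. w x * (\<Sum>z\<in>G. d x z * u z y))"
      unfolding L_def U_def by (subst sum_distrib_right, subst sum.swap) (simp add: sum_distrib_left mult.assoc)
    ultimately have "L (U w) y - U (L w) y =
        (\<Sum>x\<in>G. w x * ((\<Sum>z\<in>G. u x z * d z y) - (\<Sum>z\<in>G. d x z * u z y)))"
      by (simp add: sum_subtractf right_diff_distrib)
    also have "\<dots> = (\<Sum>x\<in>G. if x = y then w x * of_int (D - 2 * h x) else 0)"
      using y by (intro sum.cong) (auto simp: comm)
    also have "\<dots> = w y * of_int (D - 2 * h y)" using y fin by (simp add: sum.delta)
    finally show ?thesis by (simp add: algebra_simps)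
  qed
  define w where "w n = (L ^^ n) v" for n :: nat
  have supp: "h y = i - int n" if "y \<in> G" "w n y \<noteq> 0" for n y
    using that
  proof (induction n arbitrary: y)
    case 0 then show ?case by (auto simp: w_def v_def split: if_splits)
  next
    case (Suc n)
    have "w (Suc n) y = (\<Sum>x\<in>G. w n x * d x y)" by (simp add: w_def L_def)
    with Suc.prems have "(\<Sum>x\<in>G. w n x * d x y) \<noteq> 0" by simp
    then obtain x where "x \<in> G" "w n x * d x y \<noteq> 0"
      by (rule sum.not_neutral_contains_not_neutral)
    then show ?case using Suc.IH[of x] d[of x y] Suc.prems by auto
  qed
  \<comment> \<open>The sum of D - 2h over the weights i, i - 1, ..., i - n + 1 met on the way down.
    Every summand is positive because 2i < D.\<close>
  define g where "g n = (\<Sum>j<n. D - 2 * (i - int j))" for n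
  have gpos: "g (Suc n) > 0" for n
    unfolding g_def using i by (intro sum_pos) auto
  have Uw: "U (w (Suc n)) y = - of_int (g (Suc n)) * w n y" if "y \<in> G" for n y
    using that
  proof (induction n arbitrary: y)
    case 0
    have "L (U v) y = 0" using Uv by (simp add: L_def)
    moreover have "of_int (D - 2 * h y) * v y = of_int (D - 2 * i) * v y" by (simp add: v_def)
    ultimately show ?case using LU[OF 0, of v] by (simp add: w_def g_def minus_mult_left del: of_int_diff mult_minus_left)
  next
    case (Suc n)
    have "L (U (w (Suc n))) y = (\<Sum>x\<in>G. - of_int (g (Suc n)) * (w n x * d x y))"
      unfolding L_def by (intro sum.cong) (auto simp: Suc.IH)
    also have "\<dots> = - of_int (g (Suc n)) * w (Suc n) y"
      by (simp only: sum_distrib_left[symmetric]) (simp add: w_def L_def)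
    finally have 1: "L (U (w (Suc n))) y = - of_int (g (Suc n)) * w (Suc n) y" .
    have "of_int (D - 2 * h y) * w (Suc n) y = of_int (D - 2 * (i - int (Suc n))) * w (Suc n) y"
      using supp[OF Suc.prems, of "Suc n"] by (cases "w (Suc n) y = 0") auto
    moreover have "w (Suc (Suc n)) = L (w (Suc n))" by (simp add: w_def)
    moreover have "of_int (g (Suc (Suc n))) = of_int (g (Suc n)) + (of_int (D - 2 * (i - int (Suc n))) :: real)"
      by (simp add: g_def)
    ultimately show ?case using LU[OF Suc.prems, of "w (Suc n)"] 1 by (simp only: distrib_right minus_add_distrib mult_minus_left)
  qed
  have step: "\<forall>y\<in>G. w n y = 0" if "\<forall>y\<in>G. w (Suc n) y = 0" for n
  proof
    fix y assume y: "y \<in> G"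
    have "U (w (Suc n)) y = 0" using that by (simp add: U_def)
    with Uw[OF y, of n] gpos[of n] show "w n y = 0" by simp
  qed
  have "\<forall>y\<in>G. w n y = 0 \<Longrightarrow> \<forall>y\<in>G. w 0 y = 0" for n by (induction n) (use step in auto)
  moreover have "\<exists>n. \<forall>y\<in>G. w n y = 0"
  proof -
    define b where "b = Min (h ` G)"
    have b: "\<forall>y\<in>G. b \<le> h y" using fin by (simp add: b_def)
    show ?thesis
    proof (intro exI ballI)
      fix y assume y: "y \<in> G"
      have "b \<le> h y" using b y by blast
      then show "w (nat (i - b + 1)) y = 0"
        using supp[OF y, of "nat (i - b + 1)"] by linarith
    qed
  qed
  ultimately have "\<forall>y\<in>G. v y = 0" by (auto simp: w_def)
  with v0(1) show False by (auto simp: v_def)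
qed

text \<open>The preceding inequality for the opposite grading: \<open>u\<close> and \<open>d\<close>
  exchange roles, \<open>h\<close> and \<open>D\<close> change sign.\<close>

lemma weight_card_ge:
  fixes u d :: "'a \<Rightarrow> 'a \<Rightarrow> real" and h :: "'a \<Rightarrow> int"
  assumes fin: "finite G"
    and u: "\<And>x y. x \<in> G \<Longrightarrow> y \<in> G \<Longrightarrow> u x y \<noteq> 0 \<Longrightarrow> h y = h x + 1"
    and d: "\<And>x y. x \<in> G \<Longrightarrow> y \<in> G \<Longrightarrow> d x y \<noteq> 0 \<Longrightarrow> h x = h y + 1"
    and comm: "\<And>x y. x \<in> G \<Longrightarrow> y \<in> G \<Longrightarrow>
      (\<Sum>z\<in>G. u x z * d z y) - (\<Sum>z\<in>G. d x z * u z y) = (if x = y then of_int (D - 2 * h x) else 0)"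
    and i: "D < 2 * i"
  shows "card {x \<in> G. h x = i} \<le> card {x \<in> G. h x = i - 1}"
proof -
  have "card {x \<in> G. - h x = - i} \<le> card {x \<in> G. - h x = - i + 1}"
  proof (rule weight_card_le[OF fin, of d _ u "- D"])
    fix x y assume xy: "x \<in> G" "y \<in> G"
    show "(\<Sum>z\<in>G. d x z * u z y) - (\<Sum>z\<in>G. u x z * d z y) =
      (if x = y then of_int (- D - 2 * (- h x)) else 0)"
      using comm[OF xy] by (auto split: if_splits)
  qed (use u d i in force)+
  moreover have "- h x = - i + 1 \<longleftrightarrow> h x = i - 1" for x by auto
  ultimately show ?thesis by simp
qed

section \<open>Divided differences and a residue identity\<close>

text \<open>The divided difference of \<open>p\<close> at the nodes \<open>S\<close>. For polynomial
  \<open>p\<close> it is the sum of the residues of p(x) / \<Prod>(x - s) over the simple poles s in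
  \<open>S\<close>.\<close>

definition divdiff :: "'a::field set \<Rightarrow> ('a \<Rightarrow> 'a) \<Rightarrow> 'a" where
  "divdiff S p = (\<Sum>s\<in>S. p s / (\<Prod>t\<in>S - {s}. s - t))"

lemma divdiff_linear:
  "divdiff S (\<lambda>x. p x + c * r x) = divdiff S p + c * divdiff S r"
  by (simp add: divdiff_def add_divide_distrib sum.distrib sum_distrib_left)

text \<open>The factor x - a kills the term of the node \<open>a\<close> and cancels one denominator
  factor at every other node.\<close>

lemma divdiff_factor:
  assumes "finite S" "a \<in> S"
  shows "divdiff S (\<lambda>x. (x - a) * p x) = divdiff (S - {a}) p"
proof -
  have "divdiff S (\<lambda>x. (x - a) * p x) = (\<Sum>s\<in>S - {a}. (s - a) * p s / (\<Prod>t\<in>S - {s}. s - t))"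
    using assms by (simp add: divdiff_def sum.remove)
  also have "\<dots> = divdiff (S - {a}) p"
    unfolding divdiff_def
  proof (rule sum.cong)
    fix s assume s: "s \<in> S - {a}"
    have "(\<Prod>t\<in>S - {s}. s - t) = (s - a) * (\<Prod>t\<in>S - {s} - {a}. s - t)"
      using assms s by (subst prod.remove[of _ a]) auto
    moreover have "S - {s} - {a} = S - {a} - {s}" by auto
    ultimately show "(s - a) * p s / (\<Prod>t\<in>S - {s}. s - t) = p s / (\<Prod>t\<in>S - {a} - {s}. s - t)"
      using s by auto
  qed simp
  finally show ?thesis .
qed

text \<open>The constant b - a is the difference of x - a and x - b. Each of these deletes a node,
  and the two smaller divided differences agree: both are 0 by induction, or both are 1 when a
  single node is left.\<close>

lemma divdiff_const:
  assumes "finite S" "card S > 1"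
  shows "divdiff S (\<lambda>_. 1 :: 'a::field) = 0"
  using assms
proof (induction "card S" arbitrary: S rule: less_induct)
  case less
  from less.prems obtain a b where ab: "a \<in> S" "b \<in> S" "a \<noteq> b"
    by (metis card_le_Suc0_iff_eq One_nat_def not_le)
  have 1: "divdiff (S - {a}) (\<lambda>_. 1) = divdiff (S - {b}) (\<lambda>_. 1)"
  proof (cases "card S = 2")
    case True
    then have "{a, b} = S" using ab less.prems by (intro card_subset_eq) auto
    then have "S - {a} = {b}" "S - {b} = {a}" using ab by auto
    then show ?thesis by (simp add: divdiff_def)
  next
    case False
    then have "divdiff (S - {x}) (\<lambda>_. 1) = 0" if "x \<in> S" for x
      using less.prems that by (intro less.hyps) (auto simp: card_Diff_singleton)
    then show ?thesis using ab by simp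
  qed
  have "divdiff S (\<lambda>x. (x - a) * 1 + (- 1) * ((x - b) * 1)) = 0"
    using 1 ab less.prems by (simp only: divdiff_linear divdiff_factor) simp
  then have "divdiff S (\<lambda>x. 0 + (b - a) * 1) = 0" by (simp add: algebra_simps)
  then have "divdiff S (\<lambda>x. 0) + (b - a) * divdiff S (\<lambda>_. 1) = 0" by (simp only: divdiff_linear)
  then show ?case using ab by (simp add: divdiff_def)
qed

text \<open>Writes x - r j as (x - a) + (a - r j), trading a factor of the product for the node
  \<open>a\<close>. This recursion drives the three evaluations that follow.\<close>

lemma divdiff_prod_step:
  assumes "finite S" "a \<in> S" "finite J" "j \<notin> J"
  shows "divdiff S (\<lambda>x. \<Prod>i\<in>insert j J. x - r i) =
    divdiff (S - {a}) (\<lambda>x. \<Prod>i\<in>J. x - r i) + (a - r j) * divdiff S (\<lambda>x. \<Prod>i\<in>J. x - r i)"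
proof -
  have "(\<lambda>x. \<Prod>i\<in>insert j J. x - r i) =
    (\<lambda>x. (x - a) * (\<Prod>i\<in>J. x - r i) + (a - r j) * (\<Prod>i\<in>J. x - r i))"
    using assms by (auto simp: algebra_simps)
  then show ?thesis using assms by (simp only: divdiff_linear divdiff_factor)
qed

lemma divdiff_prod_lt:
  assumes "finite J" "finite S" "card J + 1 < card S"
  shows "divdiff S (\<lambda>x. \<Prod>i\<in>J. x - r i) = 0"
  using assms
proof (induction J arbitrary: S rule: finite_induct)
  case empty then show ?case by (simp add: divdiff_const)
next
  case (insert j J)
  then obtain a where "a \<in> S" by fastforce
  then show ?case using insert by (simp add: divdiff_prod_step[of S a] del: prod.insert)
qed

lemma divdiff_prod_pred:
  assumes "finite J" "finite S" "card J + 1 = card S"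
  shows "divdiff S (\<lambda>x. \<Prod>i\<in>J. x - r i) = 1"
  using assms
proof (induction J arbitrary: S rule: finite_induct)
  case empty
  then obtain a where "S = {a}" by (metis card_1_singletonE card.empty add_0)
  then show ?case by (simp add: divdiff_def)
next
  case (insert j J)
  then obtain a where "a \<in> S" by fastforce
  then show ?case using insert by (simp add: divdiff_prod_step[of S a] divdiff_prod_lt del: prod.insert)
qed

text \<open>A divided difference on n nodes sees only the two top coefficients of a monic polynomial
  of degree n: x^n contributes the sum of the nodes, and the next coefficient, minus the sum of the
  roots, contributes itself.\<close>

lemma divdiff_prod_eq:
  assumes "finite J" "finite S" "card J = card S"
  shows "divdiff S (\<lambda>x. \<Prod>i\<in>J. x - r i) = \<Sum>S - (\<Sum>i\<in>J. r i)"
  using assms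
proof (induction J arbitrary: S rule: finite_induct)
  case empty
  then show ?case by (simp add: divdiff_def)
next
  case (insert j J)
  then obtain a where "a \<in> S" by fastforce
  then show ?case using insert
    by (simp add: divdiff_prod_step[of S a] divdiff_prod_pred sum_diff1 del: prod.insert)
qed

text \<open>The sum of the residues of
  \<open>\<Prod>\<^sub>y(t - y) \<Prod>\<^sub>z(t + 1 - z) / \<Prod>\<^sub>x(t - x)(t + 1 - x)\<close>.\<close>

lemma residue_sum:
  fixes X Y Z :: "'a::field set"
  assumes fin: "finite X" "finite Y" "finite Z"
    and card: "card Y = card X + 1" "card Z + 1 = card X"
    and coll: "\<And>t. t \<in> X \<Longrightarrow> t + 1 \<in> X \<Longrightarrow> t \<in> Y \<and> t + 1 \<in> Z"
  shows "(\<Sum>s\<in>X. (\<Prod>y\<in>Y. s - y) * (\<Prod>z\<in>Z. s + 1 - z) /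
      ((\<Prod>t\<in>X - {s}. s - t) * (\<Prod>t\<in>X - {s}. s + 1 - t))) -
    (\<Sum>s\<in>X. (\<Prod>y\<in>Y. s - 1 - y) * (\<Prod>z\<in>Z. s - z) /
      ((\<Prod>t\<in>X - {s}. s - 1 - t) * (\<Prod>t\<in>X - {s}. s - t))) =
    2 * \<Sum>X - \<Sum>Y - \<Sum>Z - 1"
    (is "?A - ?B = _")
proof -
  let ?dec = "\<lambda>t::'a. t - 1"
  define X' where "X' = ?dec ` X"
  define Z' where "Z' = ?dec ` Z"
  \<comment> \<open>The points t with t and t + 1 both in \<open>X\<close>, where the rational
    function would have a double pole. There \<open>coll\<close> supplies two zeros of the
    numerator. The corresponding terms of the two sums have denominator 0 and numerator 0, so they
    contribute nothing.\<close>
  define C where "C = X \<inter> X'"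
  have inj: "inj_on ?dec A" for A by (simp add: inj_on_def)
  have fin': "finite X'" "finite Z'" "finite C" using fin by (auto simp: X'_def Z'_def C_def)
  have C: "C \<subseteq> X" "C \<subseteq> X'" "C \<subseteq> Y" "C \<subseteq> Z'"
    using coll by (force simp: C_def X'_def Z'_def image_iff)+
  define S where "S = (X - C) \<union> (X' - C)"
  have disj: "(X - C) \<inter> (X' - C) = {}" by (auto simp: C_def)
  \<comment> \<open>A tagged union, because \<open>Y\<close> and \<open>Z'\<close> may still share
    points outside \<open>C\<close>, and a common root has to count twice.\<close>
  define J where "J = (Y - C) <+> (Z' - C)"
  define r :: "'a + 'a \<Rightarrow> 'a" where "r = case_sum id id"
  have cardX': "card X' = card X" "card Z' = card Z"
    by (simp_all add: X'_def Z'_def card_image inj)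
  have cS: "card S = 2 * card X - 2 * card C"
    unfolding S_def using fin fin' disj C cardX'
    by (simp add: card_Un_disjoint card_Diff_subset)
  have cJ: "card J = 2 * card X - 2 * card C"
    unfolding J_def using fin fin' C cardX' card card_mono[OF fin(1) C(1)] card_mono[OF fin'(2) C(4)]
    by (simp add: card_Plus card_Diff_subset)
  have finSJ: "finite S" "finite J" using fin fin' by (auto simp: S_def J_def)
  define N where "N s = (\<Prod>i\<in>J. s - r i)" for s
  have N: "N s * (\<Prod>c\<in>C. s - c) * (\<Prod>c\<in>C. s - c) = (\<Prod>y\<in>Y. s - y) * (\<Prod>z\<in>Z'. s - z)" for s
    unfolding N_def J_def using fin fin' C
    by (simp add: prod.Plus r_def prod.subset_diff[of C Y] prod.subset_diff[of C Z'] mult_ac)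
  have Ds: "(\<Prod>t\<in>S - {s}. s - t) * (\<Prod>c\<in>C. s - c) * (\<Prod>c\<in>C. s - c) =
      (\<Prod>t\<in>X - {s}. s - t) * (\<Prod>t\<in>X' - {s}. s - t)" if "s \<notin> C" for s
  proof -
    have "S - {s} = (X - {s} - C) \<union> (X' - {s} - C)" by (auto simp: S_def)
    moreover have "(\<Prod>t\<in>X - {s}. s - t) = (\<Prod>t\<in>X - {s} - C. s - t) * (\<Prod>c\<in>C. s - c)"
      using that C fin by (intro prod.subset_diff) auto
    moreover have "(\<Prod>t\<in>X' - {s}. s - t) = (\<Prod>t\<in>X' - {s} - C. s - t) * (\<Prod>c\<in>C. s - c)"
      using that C fin' by (intro prod.subset_diff) auto
    moreover have "(\<Prod>t\<in>(X - {s} - C) \<union> (X' - {s} - C). s - t) =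
        (\<Prod>t\<in>X - {s} - C. s - t) * (\<Prod>t\<in>X' - {s} - C. s - t)"
      using disj fin fin' by (intro prod.union_disjoint) auto
    ultimately show ?thesis by (simp only: mult_ac)
  qed
  have nz: "(\<Prod>c\<in>C. s - c) \<noteq> 0" if "s \<notin> C" for s using that fin' by auto
  have quot: "N s / (\<Prod>t\<in>S - {s}. s - t) = (\<Prod>y\<in>Y. s - y) * (\<Prod>z\<in>Z'. s - z) /
      ((\<Prod>t\<in>X - {s}. s - t) * (\<Prod>t\<in>X' - {s}. s - t))" if "s \<notin> C" for s
    using nz[OF that] by (simp add: N[symmetric] Ds[OF that, symmetric])
  have vanish: "(\<Prod>y\<in>Y. s - y) = 0" if "s \<in> C" for s using that C fin by auto
  have Z': "(\<Prod>z\<in>Z'. s - z) = (\<Prod>z\<in>Z. s + 1 - z)" for s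
    unfolding Z'_def by (subst prod.reindex[OF inj]) (simp add: algebra_simps)
  have X': "(\<Prod>t\<in>X' - {s - 1}. s' - t) = (\<Prod>t\<in>X - {s}. s' + 1 - t)" for s s'
  proof -
    have "X' - {s - 1} = ?dec ` (X - {s})" by (auto simp: X'_def)
    then show ?thesis by (simp add: prod.reindex[OF inj] algebra_simps)
  qed
  have "divdiff S N = (\<Sum>s\<in>X - C. N s / (\<Prod>t\<in>S - {s}. s - t)) + (\<Sum>s\<in>X' - C. N s / (\<Prod>t\<in>S - {s}. s - t))"
    unfolding divdiff_def using fin fin' disj by (subst (2) S_def) (simp add: sum.union_disjoint)
  also have "(\<Sum>s\<in>X - C. N s / (\<Prod>t\<in>S - {s}. s - t)) =
      (\<Sum>s\<in>X. (\<Prod>y\<in>Y. s - y) * (\<Prod>z\<in>Z'. s - z) / ((\<Prod>t\<in>X - {s}. s - t) * (\<Prod>t\<in>X' - {s}. s - t)))"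
    using fin vanish C by (intro sum.mono_neutral_cong_left) (auto simp: quot)
  also have "\<dots> = ?A"
  proof (rule sum.cong)
    fix s assume s: "s \<in> X"
    show "(\<Prod>y\<in>Y. s - y) * (\<Prod>z\<in>Z'. s - z) / ((\<Prod>t\<in>X - {s}. s - t) * (\<Prod>t\<in>X' - {s}. s - t)) =
      (\<Prod>y\<in>Y. s - y) * (\<Prod>z\<in>Z. s + 1 - z) / ((\<Prod>t\<in>X - {s}. s - t) * (\<Prod>t\<in>X - {s}. s + 1 - t))"
    proof (cases "s \<in> C")
      case False
      then have "s \<notin> X'" using s by (auto simp: C_def)
      moreover have "s - 1 \<in> X'" using s by (auto simp: X'_def)
      \<comment> \<open>The left product has the additional node s - 1, whose factor is s - (s - 1)
        = 1.\<close>
      ultimately have "(\<Prod>t\<in>X' - {s}. s - t) = (\<Prod>t\<in>X' - {s - 1}. s - t)"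
        using fin' by (simp add: prod.remove)
      then show ?thesis by (simp only: Z' X')
    qed (simp add: vanish)
  qed simp
  also have "(\<Sum>s\<in>X' - C. N s / (\<Prod>t\<in>S - {s}. s - t)) =
      (\<Sum>s\<in>X'. (\<Prod>y\<in>Y. s - y) * (\<Prod>z\<in>Z'. s - z) / ((\<Prod>t\<in>X - {s}. s - t) * (\<Prod>t\<in>X' - {s}. s - t)))"
    using fin' vanish C by (intro sum.mono_neutral_cong_left) (auto simp: quot)
  also have "\<dots> = (\<Sum>s\<in>X. (\<Prod>y\<in>Y. s - 1 - y) * (\<Prod>z\<in>Z. s - z) /
      ((\<Prod>t\<in>X - {s - 1}. s - 1 - t) * (\<Prod>t\<in>X - {s}. s - t)))"
    by (subst X'_def, subst sum.reindex[OF inj]) (simp add: Z' X')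
  also have "\<dots> = - ?B"
    unfolding sum_negf[symmetric]
  proof (rule sum.cong)
    fix s assume s: "s \<in> X"
    show "(\<Prod>y\<in>Y. s - 1 - y) * (\<Prod>z\<in>Z. s - z) /
        ((\<Prod>t\<in>X - {s - 1}. s - 1 - t) * (\<Prod>t\<in>X - {s}. s - t)) =
      - ((\<Prod>y\<in>Y. s - 1 - y) * (\<Prod>z\<in>Z. s - z) /
        ((\<Prod>t\<in>X - {s}. s - 1 - t) * (\<Prod>t\<in>X - {s}. s - t)))"
    proof (cases "s - 1 \<in> C")
      case False
      then have "s - 1 \<notin> X" using s by (auto simp: C_def X'_def)
      \<comment> \<open>Here the additional node is s, with factor (s - 1) - s = -1. This is the
        origin of the minus sign before \<open>?B\<close>.\<close>
      then have "(\<Prod>t\<in>X - {s - 1}. s - 1 - t) = - (\<Prod>t\<in>X - {s}. s - 1 - t)"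
        using s fin by (simp add: prod.remove)
      then show ?thesis by simp
    qed (simp add: vanish)
  qed simp
  finally have "?A - ?B = divdiff S N" by simp
  also have "\<dots> = \<Sum>S - (\<Sum>i\<in>J. r i)"
    unfolding N_def using finSJ cS cJ by (intro divdiff_prod_eq) auto
  also have "\<Sum>S = \<Sum>X + \<Sum>X' - 2 * \<Sum>C"
    unfolding S_def using fin fin' disj C
    by (simp add: sum.union_disjoint sum_diff)
  also have "(\<Sum>i\<in>J. r i) = \<Sum>Y + \<Sum>Z' - 2 * \<Sum>C"
    unfolding J_def using fin fin' C by (simp add: sum.Plus r_def sum_diff)
  also have "\<Sum>X' = \<Sum>X - of_nat (card X)"
    unfolding X'_def by (subst sum.reindex[OF inj]) (simp add: sum_subtractf)
  also have "\<Sum>Z' = \<Sum>Z - of_nat (card Z)"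
    unfolding Z'_def by (subst sum.reindex[OF inj]) (simp add: sum_subtractf)
  also have "of_nat (card X) = (of_nat (card Z) + 1 :: 'a)" using card(2)[symmetric] by simp
  finally show ?thesis by simp
qed

section \<open>Gelfand--Tsetlin patterns\<close>

text \<open>Row k has the k entries (k, 0), ..., (k, k - 1), and row M is the top row. The value 0
  off the triangle makes patterns comparable as functions, so that a move is a plain function
  update.\<close>

definition gt_patterns :: "nat \<Rightarrow> (nat \<Rightarrow> nat) \<Rightarrow> (nat \<times> nat \<Rightarrow> nat) set" where
  "gt_patterns M l = {P. (\<forall>i<M. P (M, i) = l i) \<and>
     (\<forall>k<M. \<forall>i<k. P (Suc k, Suc i) \<le> P (k, i) \<and> P (k, i) \<le> P (Suc k, i)) \<and>
     (\<forall>k i. M < k \<or> k \<le> i \<longrightarrow> P (k, i) = 0)}"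

definition row_sum :: "(nat \<times> nat \<Rightarrow> nat) \<Rightarrow> nat \<Rightarrow> nat" where
  "row_sum P k = (\<Sum>i<k. P (k, i))"

text \<open>The top row is left out. With R_k the sum of row k, the letter of row k has exponent R_k
  - R_(k-1); if this letter is q^(M-k), summation by parts turns the total power of q into the sum
  of R_k over k < M.\<close>

definition gt_weight :: "nat \<Rightarrow> (nat \<times> nat \<Rightarrow> nat) \<Rightarrow> nat" where
  "gt_weight M P = (\<Sum>k<M. row_sum P k)"

definition incr :: "'a \<Rightarrow> ('a \<Rightarrow> nat) \<Rightarrow> 'a \<Rightarrow> nat" where
  "incr p P = P(p := Suc (P p))"

text \<open>The shift by the position in the row turns weakly decreasing rows into strictly
  decreasing ones, so the entries of a row become distinct nodes.\<close>

definition gt_pos :: "(nat \<times> nat \<Rightarrow> nat) \<Rightarrow> nat \<times> nat \<Rightarrow> real" where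
  "gt_pos P p = real (P p) - real (snd p)"

text \<open>The matrix coefficients of the generators \<open>E\<^sub>k\<^sub>,\<^sub>k\<^sub>+\<^sub>1\<close> and \<open>E\<^sub>k\<^sub>+\<^sub>1\<^sub>,\<^sub>k\<close> of \<open>gl\<^sub>M\<close> in the
  Gelfand--Tsetlin basis, without the normalisation that would introduce square roots.
  The factor \<open>k (M - k)\<close> makes the sums over \<open>k\<close> span the principal \<open>sl\<^sub>2\<close>.\<close>

definition gt_up :: "nat \<Rightarrow> nat \<times> nat \<Rightarrow> (nat \<times> nat \<Rightarrow> nat) \<Rightarrow> real" where
  "gt_up M = (\<lambda>(k, i) P. - (real k * (real M - real k)) *
     (\<Prod>j<Suc k. gt_pos P (k, i) - gt_pos P (Suc k, j)) /
     (\<Prod>j\<in>{..<k} - {i}. gt_pos P (k, i) - gt_pos P (k, j)))"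

definition gt_down :: "nat \<times> nat \<Rightarrow> (nat \<times> nat \<Rightarrow> nat) \<Rightarrow> real" where
  "gt_down = (\<lambda>(k, i) P. (\<Prod>j<k - 1. gt_pos P (k, i) + 1 - gt_pos P (k - 1, j)) /
     (\<Prod>j\<in>{..<k} - {i}. gt_pos P (k, i) + 1 - gt_pos P (k, j)))"

lemma gt_pos_incr: "gt_pos (incr p P) r = gt_pos P r + (if r = p then 1 else 0)"
  by (simp add: gt_pos_def incr_def)

lemma incr_commute: "incr p (incr r P) = incr r (incr p P)"
  by (auto simp: incr_def fun_eq_iff)

lemma incr_inject [simp]: "incr p P = incr p R \<longleftrightarrow> P = R"
  by (auto simp: incr_def fun_eq_iff split: if_splits)

text \<open>The raising coefficient at row k involves rows k and k + 1, the lowering coefficient at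
  row k' involves rows k' and k' - 1. Hence they interact only if k' is k or k + 1. In either case a
  single pair of factors changes, by (a - b - 1)(b - a) = (a - b)(b + 1 - a).\<close>

lemma gt_up_down_commute:
  assumes "p \<noteq> r" and p: "p = (k, i)" "i < k" and r: "r = (k', i')" "i' < k'"
  shows "gt_up M p (incr r P) * gt_down r (incr p P) = gt_up M p P * gt_down r P"
proof -
  consider "k' = k" "i \<noteq> i'" | "k' = Suc k" | "k' \<noteq> k" "k' \<noteq> Suc k" using assms by auto
  then show ?thesis
  proof cases
    case 1
    let ?x = "gt_pos P (k, i)" and ?x' = "gt_pos P (k, i')"
    have "(\<Prod>j\<in>{..<k} - {i}. gt_pos (incr r P) (k, i) - gt_pos (incr r P) (k, j)) =
        (?x - ?x' - 1) * (\<Prod>j\<in>{..<k} - {i} - {i'}. ?x - gt_pos P (k, j))"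
      using 1 r p by (subst prod.remove[of _ i']) (auto simp: gt_pos_incr intro!: prod.cong)
    moreover have "(\<Prod>j\<in>{..<k} - {i'}. gt_pos (incr p P) (k, i') + 1 - gt_pos (incr p P) (k, j)) =
        (?x' - ?x) * (\<Prod>j\<in>{..<k} - {i'} - {i}. ?x' + 1 - gt_pos P (k, j))"
      using 1 r p by (subst prod.remove[of _ i]) (auto simp: gt_pos_incr intro!: prod.cong)
    moreover have "(\<Prod>j\<in>{..<k} - {i}. ?x - gt_pos P (k, j)) =
        (?x - ?x') * (\<Prod>j\<in>{..<k} - {i} - {i'}. ?x - gt_pos P (k, j))"
      using 1 r p by (subst prod.remove[of _ i']) auto
    moreover have "(\<Prod>j\<in>{..<k} - {i'}. ?x' + 1 - gt_pos P (k, j)) =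
        (?x' + 1 - ?x) * (\<Prod>j\<in>{..<k} - {i'} - {i}. ?x' + 1 - gt_pos P (k, j))"
      using 1 r p by (subst prod.remove[of _ i]) auto
    moreover have "(\<Prod>j<Suc k. gt_pos (incr r P) (k, i) - gt_pos (incr r P) (Suc k, j)) =
        (\<Prod>j<Suc k. ?x - gt_pos P (Suc k, j))"
      using 1 r p by (intro prod.cong) (auto simp: gt_pos_incr)
    moreover have "(\<Prod>j<k - 1. gt_pos (incr p P) (k, i') + 1 - gt_pos (incr p P) (k - 1, j)) =
        (\<Prod>j<k - 1. ?x' + 1 - gt_pos P (k - 1, j))"
      using 1 r p by (intro prod.cong) (auto simp: gt_pos_incr)
    moreover have "a / ((?x - ?x' - 1) * b) * (c / ((?x' - ?x) * d)) =
        a / ((?x - ?x') * b) * (c / ((?x' + 1 - ?x) * d))" for a b c d :: real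
    proof -
      have "(?x - ?x' - 1) * b * ((?x' - ?x) * d) = (?x - ?x') * b * ((?x' + 1 - ?x) * d)"
        by (simp add: algebra_simps)
      then show ?thesis unfolding times_divide_times_eq by simp
    qed
    ultimately show ?thesis using 1 p r
      by (simp only: gt_up_def gt_down_def prod.case)
  next
    case 2
    let ?x = "gt_pos P (k, i)" and ?y = "gt_pos P (Suc k, i')"
    have "(\<Prod>j<Suc k. gt_pos (incr r P) (k, i) - gt_pos (incr r P) (Suc k, j)) =
        (?x - ?y - 1) * (\<Prod>j\<in>{..<Suc k} - {i'}. ?x - gt_pos P (Suc k, j))"
      using 2 r p by (subst prod.remove[of _ i']) (auto simp: gt_pos_incr intro!: prod.cong)
    moreover have "(\<Prod>j<k. gt_pos (incr p P) (Suc k, i') + 1 - gt_pos (incr p P) (k, j)) =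
        (?y - ?x) * (\<Prod>j\<in>{..<k} - {i}. ?y + 1 - gt_pos P (k, j))"
      using 2 r p by (subst prod.remove[of _ i]) (auto simp: gt_pos_incr intro!: prod.cong)
    moreover have "(\<Prod>j<Suc k. ?x - gt_pos P (Suc k, j)) =
        (?x - ?y) * (\<Prod>j\<in>{..<Suc k} - {i'}. ?x - gt_pos P (Suc k, j))"
      using 2 r p by (subst prod.remove[of _ i']) auto
    moreover have "(\<Prod>j<k. ?y + 1 - gt_pos P (k, j)) =
        (?y + 1 - ?x) * (\<Prod>j\<in>{..<k} - {i}. ?y + 1 - gt_pos P (k, j))"
      using 2 r p by (subst prod.remove[of _ i]) auto
    moreover have "(?x - ?y - 1) * (?y - ?x) = (?x - ?y) * (?y + 1 - ?x)" by (simp add: algebra_simps)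
    ultimately show ?thesis using 2 p r
      by (simp add: gt_up_def gt_down_def gt_pos_incr del: prod.lessThan_Suc)
  next
    case 3
    have "gt_up M p (incr r P) = gt_up M p P" using 3 p r by (simp add: gt_up_def gt_pos_incr)
    moreover have "gt_down r (incr p P) = gt_down r P"
      using 3 p r by (auto simp: gt_down_def gt_pos_incr intro!: arg_cong2[where f="(/)"] prod.cong)
    ultimately show ?thesis by simp
  qed
qed

lemma gt_min:
  assumes "P \<in> gt_patterns M l" "R \<in> gt_patterns M l"
  shows "(\<lambda>p. min (P p) (R p)) \<in> gt_patterns M l"
  using assms unfolding gt_patterns_def by (auto intro: min.coboundedI1 min.coboundedI2)

lemma gt_max:
  assumes "P \<in> gt_patterns M l" "R \<in> gt_patterns M l"
  shows "(\<lambda>p. max (P p) (R p)) \<in> gt_patterns M l"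
  using assms unfolding gt_patterns_def by (auto intro: max.coboundedI1 max.coboundedI2)

text \<open>Patterns form a lattice under pointwise minimum and maximum. A common upper neighbour of
  \<open>x\<close> and \<open>y\<close> is their maximum, a common lower neighbour their minimum, so
  going up and then down is possible exactly when going down and then up is.\<close>

lemma incr_diamond:
  assumes "x \<in> gt_patterns M l" "y \<in> gt_patterns M l" "p \<noteq> r"
  shows "incr p x = incr r y \<and> incr p x \<in> gt_patterns M l \<longleftrightarrow>
    (\<exists>z\<in>gt_patterns M l. x = incr r z \<and> y = incr p z)"
proof
  assume L: "incr p x = incr r y \<and> incr p x \<in> gt_patterns M l"
  let ?z = "\<lambda>s. min (x s) (y s)"
  have e: "(if s = p then Suc (x p) else x s) = (if s = r then Suc (y r) else y s)" for s
    using L unfolding incr_def fun_eq_iff by (metis fun_upd_apply)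
  have "x = incr r ?z" "y = incr p ?z"
  proof -
    show "x = incr r ?z"
    proof
      fix s show "x s = incr r ?z s"
        using e[of s] assms(3) by (auto simp: incr_def split: if_splits)
    qed
    show "y = incr p ?z"
    proof
      fix s show "y s = incr p ?z s"
        using e[of s] assms(3) by (auto simp: incr_def split: if_splits)
    qed
  qed
  with gt_min[OF assms(1,2)] show "\<exists>z\<in>gt_patterns M l. x = incr r z \<and> y = incr p z" by blast
next
  assume "\<exists>z\<in>gt_patterns M l. x = incr r z \<and> y = incr p z"
  then obtain z where z: "x = incr r z" "y = incr p z" by blast
  then have "incr p x = incr r y" by (simp add: incr_commute)
  moreover have "incr p x = (\<lambda>s. max (x s) (y s))"
    using z assms(3) by (auto simp: incr_def fun_eq_iff)
  ultimately show "incr p x = incr r y \<and> incr p x \<in> gt_patterns M l"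
    using gt_max[OF assms(1,2)] by simp
qed

lemma gt_antimono:
  assumes P: "P \<in> gt_patterns M l" and "k \<le> M" "i \<le> j" "j < k"
  shows "P (k, j) \<le> P (k, i)"
  using assms(3,4)
proof (induction j rule: dec_induct)
  case (step j)
  then obtain k' where k: "k = Suc k'" by (cases k) auto
  have "P (Suc k', Suc j) \<le> P (k', j)" "P (k', j) \<le> P (Suc k', j)"
    using P assms(2) step k by (auto simp: gt_patterns_def)
  with step k show ?case by auto
qed simp

lemma gt_pos_strict:
  assumes "P \<in> gt_patterns M l" "k \<le> M" "i < j" "j < k"
  shows "gt_pos P (k, j) < gt_pos P (k, i)"
  using gt_antimono[OF assms(1,2), of i j] assms by (simp add: gt_pos_def)

lemma gt_pos_inj:
  assumes "P \<in> gt_patterns M l" "k \<le> M"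
  shows "inj_on (\<lambda>i. gt_pos P (k, i)) {..<k}"
proof (rule inj_onI)
  fix i j assume "i \<in> {..<k}" "j \<in> {..<k}" "gt_pos P (k, i) = gt_pos P (k, j)"
  then show "i = j" using gt_pos_strict[OF assms, of i j] gt_pos_strict[OF assms, of j i]
    by (cases i j rule: linorder_cases) auto
qed

lemma sum_lessThan_real: "(\<Sum>i<n. real i) = real n * (real n - 1) / 2"
  by (induction n) (auto simp: field_simps)

lemma sum_gt_pos: "(\<Sum>i<k. gt_pos P (k, i)) = real (row_sum P k) - real k * (real k - 1) / 2"
  by (simp add: gt_pos_def sum_subtractf sum_lessThan_real row_sum_def)

text \<open>\<open>residue_sum\<close> for the shifted entries of three consecutive rows: row k
  gives the poles, rows k + 1 and k - 1 give the zeros.\<close>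

lemma gt_residue:
  assumes P: "P \<in> gt_patterns M l" and k: "0 < k" "k < M"
  defines "x \<equiv> \<lambda>i. gt_pos P (k, i)" and "y \<equiv> \<lambda>j. gt_pos P (Suc k, j)" and "z \<equiv> \<lambda>j. gt_pos P (k - 1, j)"
  shows "(\<Sum>i<k. (\<Prod>j<Suc k. x i - y j) * (\<Prod>j<k - 1. x i + 1 - z j) /
      ((\<Prod>j\<in>{..<k} - {i}. x i - x j) * (\<Prod>j\<in>{..<k} - {i}. x i + 1 - x j))) -
    (\<Sum>i<k. (\<Prod>j<Suc k. x i - 1 - y j) * (\<Prod>j<k - 1. x i - z j) /
      ((\<Prod>j\<in>{..<k} - {i}. x i - 1 - x j) * (\<Prod>j\<in>{..<k} - {i}. x i - x j))) =
    2 * real (row_sum P k) - real (row_sum P (Suc k)) - real (row_sum P (k - 1))"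
proof -
  have inj: "inj_on x {..<k}" "inj_on y {..<Suc k}" "inj_on z {..<k - 1}"
    unfolding x_def y_def z_def using P k by (auto intro!: gt_pos_inj)
  define X Y Z where "X = x ` {..<k}" and "Y = y ` {..<Suc k}" and "Z = z ` {..<k - 1}"
  \<comment> \<open>Shifted entries that differ by 1 are equal neighbours of row k. The entries of
    rows k - 1 and k + 1 squeezed between them take the same value, and these are the required
    zeros.\<close>
  have coll: "t \<in> Y \<and> t + 1 \<in> Z" if "t \<in> X" "t + 1 \<in> X" for t
  proof -
    from that obtain i j where ij: "i < k" "j < k" "x i = t" "x j = t + 1"
      by (auto simp: X_def)
    have "j < i" using gt_pos_strict[OF P, of k i j] ij k unfolding x_def
      by (cases i j rule: linorder_cases) auto
    have le: "P (k, i) \<le> P (k, j)" using gt_antimono[OF P, of k j i] ij k \<open>j < i\<close> by simp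
    have "real (P (k, j)) - real j = real (P (k, i)) - real i + 1"
      using ij by (simp add: x_def gt_pos_def)
    then have e: "P (k, j) + i = P (k, i) + j + 1" by linarith
    with le \<open>j < i\<close> have i: "i = Suc j" and eq: "P (k, j) = P (k, i)" by auto
    obtain k' where k': "k = Suc k'" using k by (cases k) auto
    have "P (k, Suc j) \<le> P (k', j)" "P (k', j) \<le> P (k, j)"
      "P (k, i) \<le> P (Suc k, i)" "P (Suc k, Suc j) \<le> P (k, j)"
      using P k ij i k' by (auto simp: gt_patterns_def)
    then have "P (k', j) = P (k, i)" "P (Suc k, i) = P (k, i)" using i eq by auto
    then have "y i = t" "z j = t + 1" using ij i k' by (auto simp: x_def y_def z_def gt_pos_def)
    moreover have "i < Suc k" "j < k - 1" using ij i k' by auto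
    ultimately show ?thesis unfolding Y_def Z_def by (metis imageI lessThan_iff)
  qed
  have card: "card Y = card X + 1" "card Z + 1 = card X"
    using k by (simp_all add: X_def Y_def Z_def card_image[OF inj(1)] card_image[OF inj(2)] card_image[OF inj(3)] del: One_nat_def)
  have diff: "(\<Prod>t\<in>X - {x i}. g t) = (\<Prod>j\<in>{..<k} - {i}. g (x j))" if "i < k" for i and g :: "real \<Rightarrow> real"
  proof -
    have "X - {x i} = x ` ({..<k} - {i})" using inj(1) that by (auto simp: X_def inj_on_def)
    then show ?thesis using inj(1) by (simp add: prod.reindex inj_on_subset)
  qed
  have sums: "\<Sum>X = (\<Sum>i<k. x i)" "\<Sum>Y = (\<Sum>i<Suc k. y i)" "\<Sum>Z = (\<Sum>i<k - 1. z i)"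
    by (simp_all add: X_def Y_def Z_def sum.reindex[OF inj(1)] sum.reindex[OF inj(2)] sum.reindex[OF inj(3)]
        del: sum.lessThan_Suc One_nat_def)
  \<comment> \<open>The position shifts contribute triangular numbers, whose second difference 1
    absorbs the constant -1.\<close>
  have main: "2 * \<Sum>X - \<Sum>Y - \<Sum>Z - 1 =
      2 * real (row_sum P k) - real (row_sum P (Suc k)) - real (row_sum P (k - 1))"
  proof -
    have "\<Sum>X = real (row_sum P k) - real k * (real k - 1) / 2"
      "\<Sum>Y = real (row_sum P (Suc k)) - real (Suc k) * (real (Suc k) - 1) / 2"
      "\<Sum>Z = real (row_sum P (k - 1)) - real (k - 1) * (real (k - 1) - 1) / 2"
      unfolding sums x_def y_def z_def by (rule sum_gt_pos)+
    then show ?thesis using k by (simp add: of_nat_diff field_simps)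
  qed
  have prods: "(\<Prod>t\<in>Y. g t) = (\<Prod>j<Suc k. g (y j))" "(\<Prod>t\<in>Z. g t) = (\<Prod>j<k - 1. g (z j))" for g :: "real \<Rightarrow> real"
    by (simp_all add: Y_def Z_def prod.reindex[OF inj(2)] prod.reindex[OF inj(3)] del: prod.lessThan_Suc One_nat_def)
  have sumX: "(\<Sum>s\<in>X. g s) = (\<Sum>i<k. g (x i))" for g :: "real \<Rightarrow> real"
    by (simp add: X_def sum.reindex inj)
  have fin: "finite X" "finite Y" "finite Z" by (auto simp: X_def Y_def Z_def)
  show ?thesis
    unfolding main[symmetric]
  proof (rule trans[OF _ residue_sum[OF fin card]])
    fix t assume "t \<in> X" "t + 1 \<in> X"
    then show "t \<in> Y \<and> t + 1 \<in> Z" by (rule coll)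
  qed (unfold prods sumX, intro arg_cong2[where f = "(-)"] sum.cong refl, simp_all add: diff del: prod.lessThan_Suc)
qed

lemma incr_in_gt_iff:
  assumes P: "P \<in> gt_patterns M l" and "i < k" "k < M"
  shows "incr (k, i) P \<in> gt_patterns M l \<longleftrightarrow>
    P (k, i) < P (Suc k, i) \<and> (0 < i \<longrightarrow> P (k, i) < P (k - 1, i - 1))"
proof
  assume A: "incr (k, i) P \<in> gt_patterns M l"
  then have "incr (k, i) P (k, i) \<le> incr (k, i) P (Suc k, i)"
    using assms by (simp add: gt_patterns_def)
  moreover have "incr (k, i) P (Suc (k - 1), Suc (i - 1)) \<le> incr (k, i) P (k - 1, i - 1)" if "0 < i"
  proof -
    have "k - 1 < M" "i - 1 < k - 1" using that assms by auto
    then show ?thesis using A unfolding gt_patterns_def by blast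
  qed
  ultimately show "P (k, i) < P (Suc k, i) \<and> (0 < i \<longrightarrow> P (k, i) < P (k - 1, i - 1))"
    using assms by (auto simp: incr_def split: if_splits)
next
  assume A: "P (k, i) < P (Suc k, i) \<and> (0 < i \<longrightarrow> P (k, i) < P (k - 1, i - 1))"
  have "incr (k, i) P (Suc k', Suc i') \<le> incr (k, i) P (k', i') \<and>
    incr (k, i) P (k', i') \<le> incr (k, i) P (Suc k', i')" if "k' < M" "i' < k'" for k' i'
  proof -
    have "P (Suc k', Suc i') \<le> P (k', i')" "P (k', i') \<le> P (Suc k', i')"
      using P that by (auto simp: gt_patterns_def)
    then show ?thesis using A by (auto simp: incr_def)
  qed
  then show "incr (k, i) P \<in> gt_patterns M l"
    using P assms unfolding gt_patterns_def by (auto simp: incr_def)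
qed

lemma ex_incr_in_gt:
  assumes P: "P \<in> gt_patterns M l" and "i < k" "k < M"
    and "P (Suc k, Suc i) < P (k, i)" "i < k - 1 \<Longrightarrow> P (k - 1, i) < P (k, i)"
  shows "\<exists>z\<in>gt_patterns M l. P = incr (k, i) z"
proof
  let ?z = "P((k, i) := P (k, i) - 1)"
  show "P = incr (k, i) ?z" using assms by (auto simp: incr_def)
  have "?z (Suc k', Suc i') \<le> ?z (k', i') \<and>
    ?z (k', i') \<le> ?z (Suc k', i')" if "k' < M" "i' < k'" for k' i'
  proof -
    have "P (Suc k', Suc i') \<le> P (k', i')" "P (k', i') \<le> P (Suc k', i')"
      using P that by (auto simp: gt_patterns_def)
    then show ?thesis using assms that by fastforce
  qed
  then show "?z \<in> gt_patterns M l"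
    using P assms unfolding gt_patterns_def by auto
qed

text \<open>An inadmissible move is blocked by equality with an entry of an adjacent row, and that
  equality makes a numerator factor 0. The sums over admissible moves therefore extend to all
  positions of the row, where \<open>gt_residue\<close> applies. The result is -k (M - k) times the
  eigenvalue of the coroot E_(k,k) - E_(k+1,k+1).\<close>

lemma gt_commutator_diag:
  assumes P: "P \<in> gt_patterns M l" and fin: "finite (gt_patterns M l)" and k: "0 < k" "k < M"
  shows "(\<Sum>i<k. if incr (k, i) P \<in> gt_patterns M l then gt_up M (k, i) P * gt_down (k, i) P else 0) -
    (\<Sum>i<k. \<Sum>z\<in>gt_patterns M l. if P = incr (k, i) z then gt_up M (k, i) z * gt_down (k, i) z else 0) =
    real k * (real M - real k) * (real (row_sum P (Suc k)) + real (row_sum P (k - 1)) - 2 * real (row_sum P k))"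
proof -
  define x y z where "x = (\<lambda>i. gt_pos P (k, i))" and "y = (\<lambda>j. gt_pos P (Suc k, j))"
    and "z = (\<lambda>j. gt_pos P (k - 1, j))"
  define c where "c = real k * (real M - real k)"
  have A: "(if incr (k, i) P \<in> gt_patterns M l then gt_up M (k, i) P * gt_down (k, i) P else 0) =
      - c * ((\<Prod>j<Suc k. x i - y j) * (\<Prod>j<k - 1. x i + 1 - z j) /
      ((\<Prod>j\<in>{..<k} - {i}. x i - x j) * (\<Prod>j\<in>{..<k} - {i}. x i + 1 - x j)))" if i: "i < k" for i
  proof (cases "incr (k, i) P \<in> gt_patterns M l")
    case True
    then show ?thesis by (simp add: gt_up_def gt_down_def x_def y_def z_def c_def del: prod.lessThan_Suc)
  next
    case False
    have "P (k, i) \<le> P (Suc k, i)" "0 < i \<Longrightarrow> P (Suc (k - 1), Suc (i - 1)) \<le> P (k - 1, i - 1)"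
      using P i k unfolding gt_patterns_def by (auto simp del: Suc_pred)
    with False incr_in_gt_iff[OF P i k(2)] k i
    have "P (k, i) = P (Suc k, i) \<or> 0 < i \<and> P (k, i) = P (k - 1, i - 1)" by auto
    then have "(\<exists>j\<in>{..<Suc k}. x i - y j = 0) \<or> (\<exists>j\<in>{..<k - 1}. x i + 1 - z j = 0)"
    proof
      assume "P (k, i) = P (Suc k, i)"
      then show ?thesis using i by (intro disjI1 bexI[of _ i]) (auto simp: x_def y_def gt_pos_def)
    next
      assume "0 < i \<and> P (k, i) = P (k - 1, i - 1)"
      then show ?thesis using i
        by (intro disjI2 bexI[of _ "i - 1"]) (auto simp: x_def z_def gt_pos_def of_nat_diff)
    qed
    then have "(\<Prod>j<Suc k. x i - y j) * (\<Prod>j<k - 1. x i + 1 - z j) = 0"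
      by (simp add: prod_zero_iff del: prod.lessThan_Suc)
    with False show ?thesis by simp
  qed
  have B: "(\<Sum>w\<in>gt_patterns M l. if P = incr (k, i) w then gt_up M (k, i) w * gt_down (k, i) w else 0) =
      - c * ((\<Prod>j<Suc k. x i - 1 - y j) * (\<Prod>j<k - 1. x i - z j) /
      ((\<Prod>j\<in>{..<k} - {i}. x i - 1 - x j) * (\<Prod>j\<in>{..<k} - {i}. x i - x j)))" if i: "i < k" for i
  proof (cases "\<exists>w\<in>gt_patterns M l. P = incr (k, i) w")
    case True
    then obtain w where w: "w \<in> gt_patterns M l" "P = incr (k, i) w" by blast
    \<comment> \<open>Since \<open>incr\<close> is injective, \<open>w\<close> is the only pattern
      below \<open>P\<close> for this move.\<close>
    have "(\<Sum>v\<in>gt_patterns M l. if P = incr (k, i) v then gt_up M (k, i) v * gt_down (k, i) v else 0) =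
        (\<Sum>v\<in>gt_patterns M l. if v = w then gt_up M (k, i) w * gt_down (k, i) w else 0)"
      using w(2) by (intro sum.cong) auto
    also have "\<dots> = gt_up M (k, i) w * gt_down (k, i) w" using fin w(1) by simp
    also have "gt_up M (k, i) w = - c * (\<Prod>j<Suc k. x i - 1 - y j) / (\<Prod>j\<in>{..<k} - {i}. x i - 1 - x j)"
    proof -
      have "(\<Prod>j\<in>{..<k} - {i}. x i - 1 - x j) = (\<Prod>j\<in>{..<k} - {i}. gt_pos w (k, i) - gt_pos w (k, j))"
        by (intro prod.cong) (auto simp: x_def w(2) gt_pos_incr)
      then show ?thesis by (simp add: gt_up_def x_def y_def c_def w(2) gt_pos_incr del: prod.lessThan_Suc)
    qed
    also have "gt_down (k, i) w = (\<Prod>j<k - 1. x i - z j) / (\<Prod>j\<in>{..<k} - {i}. x i - x j)"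
    proof -
      have "(\<Prod>j\<in>{..<k} - {i}. x i - x j) = (\<Prod>j\<in>{..<k} - {i}. gt_pos w (k, i) + 1 - gt_pos w (k, j))"
        by (intro prod.cong) (auto simp: x_def w(2) gt_pos_incr)
      moreover have "(\<Prod>j<k - 1. x i - z j) = (\<Prod>j<k - 1. gt_pos w (k, i) + 1 - gt_pos w (k - 1, j))"
        using k by (intro prod.cong) (auto simp: x_def z_def w(2) gt_pos_incr)
      ultimately show ?thesis by (simp only: gt_down_def prod.case)
    qed
    finally show ?thesis by simp
  next
    case False
    have "P (Suc k, Suc i) \<le> P (k, i)" using P i k by (auto simp: gt_patterns_def)
    moreover have "P (k - 1, i) \<le> P (Suc (k - 1), i)" if "i < k - 1"
      using P i k that unfolding gt_patterns_def by (auto simp del: Suc_pred)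
    ultimately have "P (k, i) = P (Suc k, Suc i) \<or> i < k - 1 \<and> P (k, i) = P (k - 1, i)"
      using False ex_incr_in_gt[OF P i k(2)] k by fastforce
    then have "(\<exists>j\<in>{..<Suc k}. x i - 1 - y j = 0) \<or> (\<exists>j\<in>{..<k - 1}. x i - z j = 0)"
    proof
      assume "P (k, i) = P (Suc k, Suc i)"
      then show ?thesis using i by (intro disjI1 bexI[of _ "Suc i"]) (auto simp: x_def y_def gt_pos_def)
    next
      assume "i < k - 1 \<and> P (k, i) = P (k - 1, i)"
      then show ?thesis
        by (intro disjI2 bexI[of _ "i"]) (auto simp: x_def z_def gt_pos_def)
    qed
    then have "(\<Prod>j<Suc k. x i - 1 - y j) * (\<Prod>j<k - 1. x i - z j) = 0"
      by (simp add: prod_zero_iff del: prod.lessThan_Suc)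
    then have *: "- c * ((\<Prod>j<Suc k. x i - 1 - y j) * (\<Prod>j<k - 1. x i - z j) /
      ((\<Prod>j\<in>{..<k} - {i}. x i - 1 - x j) * (\<Prod>j\<in>{..<k} - {i}. x i - x j))) = 0" by simp
    show ?thesis unfolding * using False by (intro sum.neutral) auto
  qed
  let ?E = "\<lambda>i. (\<Prod>j<Suc k. x i - y j) * (\<Prod>j<k - 1. x i + 1 - z j) /
      ((\<Prod>j\<in>{..<k} - {i}. x i - x j) * (\<Prod>j\<in>{..<k} - {i}. x i + 1 - x j))"
  let ?F = "\<lambda>i. (\<Prod>j<Suc k. x i - 1 - y j) * (\<Prod>j<k - 1. x i - z j) /
      ((\<Prod>j\<in>{..<k} - {i}. x i - 1 - x j) * (\<Prod>j\<in>{..<k} - {i}. x i - x j))"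
  have "(\<Sum>i<k. if incr (k, i) P \<in> gt_patterns M l then gt_up M (k, i) P * gt_down (k, i) P else 0) -
    (\<Sum>i<k. \<Sum>z\<in>gt_patterns M l. if P = incr (k, i) z then gt_up M (k, i) z * gt_down (k, i) z else 0) =
    (\<Sum>i<k. - c * ?E i) - (\<Sum>i<k. - c * ?F i)"
    using A B by (intro arg_cong2[where f = "(-)"] sum.cong) auto
  also have "\<dots> = - c * ((\<Sum>i<k. ?E i) - (\<Sum>i<k. ?F i))"
    by (simp only: sum_distrib_left[symmetric]) (simp only: right_diff_distrib)
  also have "(\<Sum>i<k. ?E i) - (\<Sum>i<k. ?F i) =
    2 * real (row_sum P k) - real (row_sum P (Suc k)) - real (row_sum P (k - 1))"
    using gt_residue[OF P k] unfolding x_def y_def z_def .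
  finally show ?thesis by (simp add: c_def algebra_simps)
qed

section \<open>Principal specialisation of Schur polynomials\<close>

text \<open>The default value outside the first \<open>n\<close> arguments is 0, so that elements of
  a box are themselves zero-padded sequences, such as rows of patterns and partitions.\<close>

definition box :: "nat \<Rightarrow> (nat \<Rightarrow> nat set) \<Rightarrow> (nat \<Rightarrow> nat) set" where
  "box n B = {g. (\<forall>i<n. g i \<in> B i) \<and> (\<forall>i\<ge>n. g i = 0)}"

lemma box_0: "box 0 B = {\<lambda>_. 0}"
  by (auto simp: box_def)

lemma box_Suc: "box (Suc n) B = (\<lambda>(g, b). g(n := b)) ` (box n B \<times> B n)"
proof (intro equalityI subsetI)
  fix g assume "g \<in> box (Suc n) B"
  then have "(g(n := 0), g n) \<in> box n B \<times> B n" "g = (\<lambda>(g, b). g(n := b)) (g(n := 0), g n)"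
    by (auto simp: box_def)
  then show "g \<in> (\<lambda>(g, b). g(n := b)) ` (box n B \<times> B n)" by blast
qed (auto simp: box_def less_Suc_eq)

lemma inj_on_box: "inj_on (\<lambda>(g, b). g(n := b)) (box n B \<times> B n)"
proof (rule inj_onI, clarify)
  fix g b g' b' assume A: "g \<in> box n B" "g' \<in> box n B" "g(n := b) = g'(n := b')"
  have "g i = g' i" for i
    using A by (cases "i = n") (auto simp: box_def dest: fun_cong[where x = i])
  moreover have "b = b'" using A(3) by (metis fun_upd_same)
  ultimately show "g = g' \<and> b = b'" by auto
qed

lemma finite_box: "(\<And>i. i < n \<Longrightarrow> finite (B i)) \<Longrightarrow> finite (box n B)"
  by (induction n) (auto simp: box_0 box_Suc)

lemma sum_box_prod:
  "(\<Sum>g\<in>box n B. \<Prod>i<n. f i (g i)) = (\<Prod>i<n. \<Sum>b\<in>B i. f i b :: 'a::comm_semiring_1)"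
proof (induction n)
  case (Suc n)
  have "(\<Sum>g\<in>box (Suc n) B. \<Prod>i<Suc n. f i (g i)) =
      (\<Sum>(g, b)\<in>box n B \<times> B n. \<Prod>i<Suc n. f i ((g(n := b)) i))"
    by (simp only: box_Suc sum.reindex[OF inj_on_box]) (simp add: o_def split_def)
  also have "\<dots> = (\<Sum>(g, b)\<in>box n B \<times> B n. (\<Prod>i<n. f i (g i)) * f n b)"
    by (intro sum.cong) auto
  also have "\<dots> = (\<Sum>g\<in>box n B. \<Prod>i<n. f i (g i)) * (\<Sum>b\<in>B n. f n b)"
    by (simp add: sum_product sum.cartesian_product)
  finally show ?case using Suc by simp
qed (simp add: box_0)

definition interlacing :: "nat \<Rightarrow> (nat \<Rightarrow> nat) \<Rightarrow> (nat \<Rightarrow> nat) set" where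
  "interlacing M l = box M (\<lambda>i. {l (Suc i)..l i})"

lemma finite_interlacing [simp]: "finite (interlacing M l)"
  by (simp add: interlacing_def finite_box)

text \<open>The Schur polynomial of the shape with row lengths \<open>l\<close>, evaluated at \<open>1, w, \<dots>, w\<^bsup>M-1\<^esup>\<close>,
  by the branching rule: splitting off the letter \<open>1\<close> scales the remaining ones by \<open>w\<close>.\<close>

fun schur_spec :: "'a::comm_semiring_1 \<Rightarrow> nat \<Rightarrow> (nat \<Rightarrow> nat) \<Rightarrow> 'a" where
  "schur_spec w 0 l = 1"
| "schur_spec w (Suc M) l = (\<Sum>\<mu>\<in>interlacing M l. w ^ (\<Sum>i<M. \<mu> i) * schur_spec w M \<mu>)"

lemma gt_patterns_0: "gt_patterns 0 l = {\<lambda>_. 0}"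
  by (auto simp: gt_patterns_def fun_eq_iff) (metis gr0I le0)

text \<open>The branching rule on patterns: deleting the top row leaves a pattern of one order less,
  whose own top row interlaces the deleted one.\<close>

lemma gt_patterns_Suc:
  "bij_betw (\<lambda>(\<mu>, Q) (k, i). if k = Suc M \<and> i < Suc M then l i else Q (k, i))
    (Sigma (interlacing M l) (gt_patterns M)) (gt_patterns (Suc M) l)"
  (is "bij_betw ?ext _ _")
proof (rule bij_betw_byWitness[where f' = "\<lambda>P. (\<lambda>i. P (M, i), \<lambda>(k, i). if k = Suc M then 0 else P (k, i))"])
  show "\<forall>a\<in>Sigma (interlacing M l) (gt_patterns M). (\<lambda>i. ?ext a (M, i), \<lambda>(k, i). if k = Suc M then 0 else ?ext a (k, i)) = a"
    by (auto simp: fun_eq_iff interlacing_def box_def gt_patterns_def) (metis not_le)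
  show "\<forall>P\<in>gt_patterns (Suc M) l. ?ext (\<lambda>i. P (M, i), \<lambda>(k, i). if k = Suc M then 0 else P (k, i)) = P"
    by (auto simp: fun_eq_iff gt_patterns_def)
  show "?ext ` Sigma (interlacing M l) (gt_patterns M) \<subseteq> gt_patterns (Suc M) l"
    by (auto simp: interlacing_def box_def gt_patterns_def less_Suc_eq)
  show "(\<lambda>P. (\<lambda>i. P (M, i), \<lambda>(k, i). if k = Suc M then 0 else P (k, i))) ` gt_patterns (Suc M) l
    \<subseteq> Sigma (interlacing M l) (gt_patterns M)"
    by (auto simp: interlacing_def box_def gt_patterns_def)
qed

lemma finite_gt_patterns: "finite (gt_patterns M l)"
proof (induction M arbitrary: l)
  case (Suc M)
  have "finite (Sigma (interlacing M l) (gt_patterns M))" using Suc by auto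
  then show ?case using bij_betw_finite[OF gt_patterns_Suc] by blast
qed (simp add: gt_patterns_0)

lemma schur_spec_gt: "schur_spec w M l = (\<Sum>P\<in>gt_patterns M l. w ^ gt_weight M P)"
proof (induction M arbitrary: l)
  case (Suc M)
  have "(\<Sum>P\<in>gt_patterns (Suc M) l. w ^ gt_weight (Suc M) P) =
      (\<Sum>(\<mu>, Q)\<in>Sigma (interlacing M l) (gt_patterns M).
        w ^ gt_weight (Suc M) (\<lambda>(k, i). if k = Suc M \<and> i < Suc M then l i else Q (k, i)))"
    by (subst sum.reindex_bij_betw[OF gt_patterns_Suc, symmetric]) (simp add: split_def)
  also have "\<dots> = (\<Sum>(\<mu>, Q)\<in>Sigma (interlacing M l) (gt_patterns M). w ^ (\<Sum>i<M. \<mu> i) * w ^ gt_weight M Q)"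
  proof (rule sum.cong, simp, clarify)
    fix \<mu> Q assume Q: "Q \<in> gt_patterns M \<mu>"
    let ?P = "\<lambda>(k, i). if k = Suc M \<and> i < Suc M then l i else Q (k, i)"
    have "row_sum ?P k = row_sum Q k" if "k < Suc M" for k using that by (simp add: row_sum_def)
    moreover have "row_sum Q M = (\<Sum>i<M. \<mu> i)" using Q by (simp add: row_sum_def gt_patterns_def)
    ultimately have "gt_weight (Suc M) ?P = (\<Sum>i<M. \<mu> i) + gt_weight M Q" by (simp add: gt_weight_def)
    then show "w ^ gt_weight (Suc M) ?P = w ^ (\<Sum>i<M. \<mu> i) * w ^ gt_weight M Q"
      by (simp add: power_add)
  qed
  also have "\<dots> = (\<Sum>\<mu>\<in>interlacing M l. \<Sum>Q\<in>gt_patterns M \<mu>. w ^ (\<Sum>i<M. \<mu> i) * w ^ gt_weight M Q)"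
    by (subst sum.Sigma) (auto simp: finite_gt_patterns)
  finally show ?case by (simp add: Suc sum_distrib_left)
qed (simp add: gt_patterns_0 gt_weight_def)

lemma coeff_schur_spec:
  "coeff (schur_spec [:0, 1:] M l) j = (of_nat (card {P \<in> gt_patterns M l. gt_weight M P = j}) :: 'a::comm_semiring_1)"
proof -
  have "coeff (schur_spec [:0, 1:] M l) j = (\<Sum>P\<in>gt_patterns M l. if gt_weight M P = j then 1 else (0::'a))"
    by (simp add: schur_spec_gt coeff_sum monom_altdef[of 1, symmetric, simplified])
  then show ?thesis by (simp add: finite_gt_patterns sum.If_cases Int_def)
qed

section \<open>The principal sl_2 and unimodality\<close>

text \<open>Discrete integration by parts against k (N - k), whose second difference is -2. For N =
  m + 1 the boundary term in \<open>S m\<close> vanishes and that in \<open>S (Suc m)\<close> has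
  coefficient m.\<close>

lemma second_difference_sum:
  fixes S :: "nat \<Rightarrow> real"
  assumes "S 0 = 0"
  shows "(\<Sum>k\<in>{1..<Suc m}. real k * (N - real k) * (S (Suc k) + S (k - 1) - 2 * S k)) =
    real m * (N - real m) * S (Suc m) - real (Suc m) * (N - real (Suc m)) * S m - 2 * (\<Sum>k<Suc m. S k)"
proof (induction m)
  case (Suc m)
  have "{1..<Suc (Suc m)} = insert (Suc m) {1..<Suc m}" by auto
  then show ?case using Suc by (simp add: algebra_simps)
qed (simp add: assms)

lemma gt_weight_incr:
  assumes "k < M" "i < k"
  shows "gt_weight M (incr (k, i) P) = gt_weight M P + 1"
proof -
  have "row_sum (incr (k, i) P) k' = row_sum P k' + (if k' = k then 1 else 0)" if "k' < M" for k'
  proof -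
    have "row_sum (incr (k, i) P) k' = (\<Sum>j<k'. P (k', j) + (if k' = k \<and> j = i then 1 else 0))"
      unfolding row_sum_def by (intro sum.cong) (auto simp: incr_def)
    also have "\<dots> = row_sum P k' + (if k' = k then 1 else 0)"
      using assms by (auto simp: sum.distrib row_sum_def)
    finally show ?thesis .
  qed
  then show ?thesis using assms by (simp add: gt_weight_def sum.distrib)
qed

definition gt_cells :: "nat \<Rightarrow> (nat \<times> nat) set" where
  "gt_cells M = Sigma {1..<M} (\<lambda>k. {..<k})"

definition raising :: "nat \<Rightarrow> (nat \<times> nat \<Rightarrow> nat) \<Rightarrow> (nat \<times> nat \<Rightarrow> nat) \<Rightarrow> real" where
  "raising M x y = (\<Sum>p\<in>gt_cells M. if y = incr p x then gt_up M p x else 0)"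

text \<open>\<open>gt_down\<close> takes the pattern after the lowering step, here \<open>y\<close>.
  Thus both coefficients of an edge between \<open>z\<close> and \<open>incr p z\<close> are
  evaluated at its lower end \<open>z\<close>.\<close>

definition lowering :: "nat \<Rightarrow> (nat \<times> nat \<Rightarrow> nat) \<Rightarrow> (nat \<times> nat \<Rightarrow> nat) \<Rightarrow> real" where
  "lowering M x y = (\<Sum>p\<in>gt_cells M. if x = incr p y then gt_down p y else 0)"

lemma finite_gt_cells [simp]: "finite (gt_cells M)"
  by (simp add: gt_cells_def)

lemma raising_weight: "raising M x y \<noteq> 0 \<Longrightarrow> gt_weight M y = gt_weight M x + 1"
  unfolding raising_def
  by (elim sum.not_neutral_contains_not_neutral) (auto simp: gt_cells_def gt_weight_incr split: if_splits)

lemma lowering_weight: "lowering M x y \<noteq> 0 \<Longrightarrow> gt_weight M x = gt_weight M y + 1"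
  unfolding lowering_def
  by (elim sum.not_neutral_contains_not_neutral) (auto simp: gt_cells_def gt_weight_incr split: if_splits)

text \<open>Both products expand over pairs of cells. Distinct cells cancel by
  \<open>incr_diamond\<close> and \<open>gt_up_down_commute\<close>; equal cells give the rowwise
  commutators, which \<open>second_difference_sum\<close> adds up to H.\<close>

lemma gt_commutator:
  assumes x: "x \<in> gt_patterns M l" and y: "y \<in> gt_patterns M l"
  shows "(\<Sum>z\<in>gt_patterns M l. raising M x z * lowering M z y) -
      (\<Sum>z\<in>gt_patterns M l. lowering M x z * raising M z y) =
    (if x = y then (real M - 1) * (\<Sum>i<M. real (l i)) - 2 * real (gt_weight M x) else 0)"
proof -
  let ?G = "gt_patterns M l" and ?I = "gt_cells M"
  \<comment> \<open>\<open>T1 p r\<close> goes up at \<open>p\<close> and then down at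
    \<open>r\<close>; \<open>T2 p r\<close> goes down at \<open>r\<close> and then up at
    \<open>p\<close>.\<close>
  define T1 where "T1 p r = (\<Sum>z\<in>?G. if z = incr p x \<and> z = incr r y then gt_up M p x * gt_down r y else 0)" for p r
  define T2 where "T2 p r = (\<Sum>z\<in>?G. if x = incr r z \<and> y = incr p z then gt_up M p z * gt_down r z else 0)" for p r
  have 1: "(\<Sum>z\<in>?G. raising M x z * lowering M z y) = (\<Sum>p\<in>?I. \<Sum>r\<in>?I. T1 p r)"
    unfolding raising_def lowering_def T1_def sum_product
    by (subst sum.swap, intro sum.cong refl, subst sum.swap, intro sum.cong refl) auto
  have 2: "(\<Sum>z\<in>?G. lowering M x z * raising M z y) = (\<Sum>p\<in>?I. \<Sum>r\<in>?I. T2 p r)"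
  proof -
    have "lowering M x z * raising M z y =
        (\<Sum>p\<in>?I. \<Sum>r\<in>?I. if x = incr r z \<and> y = incr p z then gt_up M p z * gt_down r z else 0)" for z
      unfolding raising_def lowering_def by (subst mult.commute) (auto simp: sum_product intro!: sum.cong)
    then show ?thesis
      unfolding T2_def by (simp only:) (subst sum.swap, intro sum.cong refl, subst sum.swap, rule refl)
  qed
  have off: "T1 p r = T2 p r" if "p \<in> ?I" "r \<in> ?I" "p \<noteq> r" for p r
  proof (cases "incr p x = incr r y \<and> incr p x \<in> ?G")
    case True
    then obtain z where z: "z \<in> ?G" "x = incr r z" "y = incr p z"
      using incr_diamond[OF x y \<open>p \<noteq> r\<close>] by blast
    have "T1 p r = (\<Sum>w\<in>?G. if w = incr p x then gt_up M p x * gt_down r y else 0)"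
      unfolding T1_def using True by (intro sum.cong) auto
    also have "\<dots> = gt_up M p (incr r z) * gt_down r (incr p z)"
      using True z by (auto simp: finite_gt_patterns incr_commute)
    also have "\<dots> = gt_up M p z * gt_down r z"
      using that by (cases p; cases r) (auto simp: gt_cells_def intro: gt_up_down_commute)
    also have "\<dots> = (\<Sum>w\<in>?G. if w = z then gt_up M p z * gt_down r z else 0)"
      using z by (simp add: finite_gt_patterns)
    also have "\<dots> = T2 p r"
      unfolding T2_def using z by (intro sum.cong) auto
    finally show ?thesis .
  next
    case False
    then have "T2 p r = 0"
      unfolding T2_def using incr_diamond[OF x y \<open>p \<noteq> r\<close>] by (intro sum.neutral) auto
    moreover have "T1 p r = 0" unfolding T1_def using False by (intro sum.neutral) auto
    ultimately show ?thesis by simp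
  qed
  have "(\<Sum>p\<in>?I. \<Sum>r\<in>?I. T1 p r) - (\<Sum>p\<in>?I. \<Sum>r\<in>?I. T2 p r) =
      (\<Sum>p\<in>?I. \<Sum>r\<in>?I. if r = p then T1 p p - T2 p p else 0)"
    unfolding sum_subtractf[symmetric] using off by (intro sum.cong) auto
  also have "\<dots> = (\<Sum>p\<in>?I. T1 p p - T2 p p)" by simp
  also have "\<dots> = (if x = y then (real M - 1) * (\<Sum>i<M. real (l i)) - 2 * real (gt_weight M x) else 0)"
  proof (cases "x = y")
    case False
    then have "T1 p p = 0" "T2 p p = 0" for p
      unfolding T1_def T2_def by (auto intro!: sum.neutral)
    then show ?thesis using False by simp
  next
    case True
    have T1: "T1 p p = (if incr p x \<in> ?G then gt_up M p x * gt_down p x else 0)" for p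
      unfolding T1_def using True by (simp add: finite_gt_patterns)
    have "(\<Sum>p\<in>?I. T1 p p - T2 p p) = (\<Sum>k\<in>{1..<M}. \<Sum>i<k. T1 (k, i) (k, i) - T2 (k, i) (k, i))"
      unfolding gt_cells_def by (subst sum.Sigma) (auto simp: split_def)
    also have "\<dots> = (\<Sum>k\<in>{1..<M}. real k * (real M - real k) *
        (real (row_sum x (Suc k)) + real (row_sum x (k - 1)) - 2 * real (row_sum x k)))"
      using gt_commutator_diag[OF x finite_gt_patterns] True
      by (intro sum.cong) (auto simp: T1 T2_def sum_subtractf)
    also have "\<dots> = (real M - 1) * (\<Sum>i<M. real (l i)) - 2 * real (gt_weight M x)"
    proof (cases M)
      case (Suc m)
      have "row_sum x M = (\<Sum>i<M. l i)" using x by (simp add: row_sum_def gt_patterns_def)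
      with Suc second_difference_sum[of "\<lambda>k. real (row_sum x k)" "real M" m] show ?thesis
        by (simp add: row_sum_def[of _ 0] gt_weight_def algebra_simps del: sum.lessThan_Suc)
    qed (simp add: gt_weight_def)
    finally show ?thesis using True by simp
  qed
  finally show ?thesis unfolding 1 2 .
qed

lemma gt_unimodal:
  fixes M l
  defines "a \<equiv> \<lambda>j. card {P \<in> gt_patterns M l. gt_weight M P = j}"
  assumes "0 < M"
  shows "2 * j < (M - 1) * (\<Sum>i<M. l i) \<Longrightarrow> a j \<le> a (Suc j)"
    and "(M - 1) * (\<Sum>i<M. l i) < 2 * j \<Longrightarrow> a j \<le> a (j - 1)"
proof -
  let ?D = "int ((M - 1) * (\<Sum>i<M. l i))"
  have comm: "(\<Sum>z\<in>gt_patterns M l. raising M x z * lowering M z y) -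
      (\<Sum>z\<in>gt_patterns M l. lowering M x z * raising M z y) =
    (if x = y then of_int (?D - 2 * int (gt_weight M x)) else 0)"
    if "x \<in> gt_patterns M l" "y \<in> gt_patterns M l" for x y
    using gt_commutator[OF that] assms(2) by (simp add: of_nat_diff)
  have a: "a j = card {P \<in> gt_patterns M l. int (gt_weight M P) = int j}" for j
    by (simp add: a_def)
  show "a j \<le> a (Suc j)" if "2 * j < (M - 1) * (\<Sum>i<M. l i)"
  proof -
    have "card {P \<in> gt_patterns M l. int (gt_weight M P) = int j} \<le>
        card {P \<in> gt_patterns M l. int (gt_weight M P) = int j + 1}"
    proof (rule weight_card_le[OF finite_gt_patterns _ _ comm])
      have "int (2 * j) < ?D" using that by (simp only: of_nat_less_iff)
      then show "2 * int j < ?D" by (simp only: of_nat_mult of_nat_numeral)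
    qed (auto dest: raising_weight lowering_weight)
    then show ?thesis unfolding a by (simp add: add.commute)
  qed
  show "a j \<le> a (j - 1)" if "(M - 1) * (\<Sum>i<M. l i) < 2 * j"
  proof -
    have "card {P \<in> gt_patterns M l. int (gt_weight M P) = int j} \<le>
        card {P \<in> gt_patterns M l. int (gt_weight M P) = int j - 1}"
    proof (rule weight_card_ge[OF finite_gt_patterns _ _ comm])
      have "?D < int (2 * j)" using that by (simp only: of_nat_less_iff)
      then show "?D < 2 * int j" by (simp only: of_nat_mult of_nat_numeral)
    qed (auto dest: raising_weight lowering_weight)
    then show ?thesis unfolding a using that by (simp add: of_nat_diff)
  qed
qed

section \<open>The Pieri rule\<close>

definition par :: "nat \<Rightarrow> (nat \<Rightarrow> nat) set" where
  "par M = {v. (\<forall>i. v (Suc i) \<le> v i) \<and> (\<forall>i\<ge>M. v i = 0)}"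

text \<open>The shapes obtained by adding a vertical strip, at most one box in each row. These are
  the terms of the Pieri rule for elementary symmetric functions.\<close>

definition vstrips :: "nat \<Rightarrow> (nat \<Rightarrow> nat) \<Rightarrow> (nat \<Rightarrow> nat) set" where
  "vstrips M v = {l \<in> par M. \<forall>i. v i \<le> l i \<and> l i \<le> Suc (v i)}"

lemma par_bounded_finite: "finite {l \<in> par M. \<forall>i. l i \<le> b i}"
proof (rule finite_subset)
  show "{l \<in> par M. \<forall>i. l i \<le> b i} \<subseteq> box M (\<lambda>i. {..b i})" by (auto simp: par_def box_def)
qed (simp add: finite_box)

lemma finite_vstrips [simp]: "finite (vstrips M v)"
  by (rule finite_subset[OF _ par_bounded_finite[of M "\<lambda>i. Suc (v i)"]]) (auto simp: vstrips_def)

lemma par_antimono: "v \<in> par M \<Longrightarrow> i \<le> j \<Longrightarrow> v j \<le> v i"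
  by (rule lift_Suc_antimono_le) (auto simp: par_def)

lemma interlacing_par:
  assumes "l \<in> par (Suc M)" "\<mu> \<in> interlacing M l"
  shows "\<mu> \<in> par M"
proof -
  have "\<mu> (Suc i) \<le> \<mu> i" for i
  proof (cases "Suc i < M")
    case True
    then have "\<mu> (Suc i) \<le> l (Suc i)" "l (Suc i) \<le> \<mu> i"
      using assms(2) by (auto simp: interlacing_def box_def)
    then show ?thesis by simp
  next
    case False then show ?thesis using assms(2) by (auto simp: interlacing_def box_def)
  qed
  then show ?thesis using assms(2) by (auto simp: interlacing_def box_def par_def)
qed

lemma power_sum_diff:
  fixes t :: "'a::comm_semiring_1" and v l :: "nat \<Rightarrow> nat"
  assumes "\<And>i. i < M \<Longrightarrow> v i \<le> l i"
  shows "t ^ ((\<Sum>i<M. l i) - (\<Sum>i<M. v i)) = (\<Prod>i<M. t ^ (l i - v i))"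
proof -
  have "(\<Sum>i<M. l i - v i) = (\<Sum>i<M. l i) - (\<Sum>i<M. v i)"
    using assms by (intro sum_subtractf_nat) auto
  then show ?thesis by (simp add: power_sum[symmetric])
qed

text \<open>Both sides factor over the rows, and the two products agree by telescoping.\<close>

lemma strips_commute:
  fixes t :: "'a::comm_semiring_1"
  assumes v: "v \<in> par (Suc M)" and \<kappa>: "\<kappa> \<in> par M"
  shows "(\<Sum>l\<in>{l \<in> vstrips (Suc M) v. \<kappa> \<in> interlacing M l}. t ^ ((\<Sum>i<Suc M. l i) - (\<Sum>i<Suc M. v i))) =
    (1 + t) * (\<Sum>\<mu>\<in>{\<mu> \<in> interlacing M v. \<kappa> \<in> vstrips M \<mu>}. t ^ ((\<Sum>i<M. \<kappa> i) - (\<Sum>i<M. \<mu> i)))"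
proof -
  \<comment> \<open>Every condition on \<open>l\<close> can be localised: given \<open>v\<close> and
    \<open>\<kappa>\<close>, the admissible values of \<open>l i\<close> form a set that depends on
    i alone. \<open>BR\<close> does the same for \<open>\<mu>\<close>, so both sums run over
    boxes.\<close>
  define BL where "BL i = {b. (b = v i \<or> b = Suc (v i)) \<and> \<kappa> i \<le> b \<and> (0 < i \<longrightarrow> b \<le> \<kappa> (i - 1))}" for i
  define BR where "BR i = {b. v (Suc i) \<le> b \<and> b \<le> v i \<and> b \<le> \<kappa> i \<and> \<kappa> i \<le> Suc b}" for i
  have vSuc: "v (Suc i) \<le> v i" and v0: "M < i \<Longrightarrow> v i = 0" for i using v by (auto simp: par_def)
  have \<kappa>Suc: "\<kappa> (Suc i) \<le> \<kappa> i" and \<kappa>0: "M \<le> i \<Longrightarrow> \<kappa> i = 0" for i using \<kappa> by (auto simp: par_def)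
  have setL: "{l \<in> vstrips (Suc M) v. \<kappa> \<in> interlacing M l} = box (Suc M) BL"
  proof (intro equalityI subsetI)
    fix l assume l: "l \<in> {l \<in> vstrips (Suc M) v. \<kappa> \<in> interlacing M l}"
    then have b: "v i \<le> l i" "l i \<le> Suc (v i)" for i by (auto simp: vstrips_def)
    have k: "l (Suc i) \<le> \<kappa> i" "\<kappa> i \<le> l i" if "i < M" for i
      using l that by (auto simp: interlacing_def box_def)
    have "l i \<in> BL i" if "i < Suc M" for i
    proof -
      have "l i = v i \<or> l i = Suc (v i)" using b[of i] by auto
      moreover have "\<kappa> i \<le> l i" using k[of i] \<kappa>0[of i] by (cases "i < M") auto
      moreover have "l i \<le> \<kappa> (i - 1)" if "0 < i" using k[of "i - 1"] that \<open>i < Suc M\<close> by auto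
      ultimately show ?thesis by (simp add: BL_def)
    qed
    then show "l \<in> box (Suc M) BL" using l by (auto simp: box_def vstrips_def par_def)
  next
    fix l assume l: "l \<in> box (Suc M) BL"
    then have b: "l i = v i \<or> l i = Suc (v i)" "\<kappa> i \<le> l i" if "i \<le> M" for i
      using that by (auto simp: box_def BL_def)
    have k: "l (Suc i) \<le> \<kappa> i" if "i < M" for i
    proof -
      have "l (Suc i) \<in> BL (Suc i)" using l that by (auto simp: box_def)
      then show ?thesis by (auto simp: BL_def)
    qed
    have z: "l i = 0" if "M < i" for i using l that by (auto simp: box_def)
    have "l (Suc i) \<le> l i" for i
      using k[of i] b(2)[of i] z[of "Suc i"] by (cases "i < M") auto
    moreover have "v i \<le> l i \<and> l i \<le> Suc (v i)" for i
      using b(1)[of i] z[of i] v0[of i] by (cases "i \<le> M") auto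
    moreover have "\<kappa> \<in> interlacing M l"
      using b(2) k \<kappa>0 by (auto simp: interlacing_def box_def)
    ultimately show "l \<in> {l \<in> vstrips (Suc M) v. \<kappa> \<in> interlacing M l}"
      using z by (auto simp: vstrips_def par_def)
  qed
  have setR: "{\<mu> \<in> interlacing M v. \<kappa> \<in> vstrips M \<mu>} = box M BR"
  proof (intro equalityI subsetI)
    fix \<mu> assume m: "\<mu> \<in> box M BR"
    have "\<mu> i \<le> \<kappa> i \<and> \<kappa> i \<le> Suc (\<mu> i)" for i
      using m \<kappa>0[of i] by (cases "i < M") (auto simp: box_def BR_def)
    then show "\<mu> \<in> {\<mu> \<in> interlacing M v. \<kappa> \<in> vstrips M \<mu>}"
      using m \<kappa> by (auto simp: interlacing_def box_def BR_def vstrips_def)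
  qed (auto simp: interlacing_def box_def BR_def vstrips_def)
  define L where "L i = (\<Sum>b\<in>BL i. t ^ (b - v i))" for i
  define R where "R i = (\<Sum>b\<in>BR i. t ^ (\<kappa> i - b))" for i
  have L: "L i = (if \<kappa> i \<le> v i \<and> (0 < i \<longrightarrow> v i \<le> \<kappa> (i - 1)) then 1 else 0) +
      (if \<kappa> i \<le> Suc (v i) \<and> (0 < i \<longrightarrow> Suc (v i) \<le> \<kappa> (i - 1)) then t else 0)" for i
  proof -
    have "BL i = {b \<in> {v i, Suc (v i)}. \<kappa> i \<le> b \<and> (0 < i \<longrightarrow> b \<le> \<kappa> (i - 1))}"
      by (auto simp: BL_def)
    then have "L i = (\<Sum>b\<in>{v i, Suc (v i)}. if \<kappa> i \<le> b \<and> (0 < i \<longrightarrow> b \<le> \<kappa> (i - 1)) then t ^ (b - v i) else 0)"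
      unfolding L_def by (simp only: sum.inter_filter finite.intros)
    also have "\<dots> = (if \<kappa> i \<le> v i \<and> (0 < i \<longrightarrow> v i \<le> \<kappa> (i - 1)) then t ^ (v i - v i) else 0) +
        (if \<kappa> i \<le> Suc (v i) \<and> (0 < i \<longrightarrow> Suc (v i) \<le> \<kappa> (i - 1)) then t ^ (Suc (v i) - v i) else 0)"
      by simp
    also have "t ^ (v i - v i) = 1" by simp
    also have "t ^ (Suc (v i) - v i) = t" by simp
    finally show ?thesis .
  qed
  have R: "R i = (if v (Suc i) \<le> \<kappa> i \<and> \<kappa> i \<le> v i then 1 else 0) +
      (if v (Suc i) < \<kappa> i \<and> \<kappa> i \<le> Suc (v i) then t else 0)" for i
  proof (cases "\<kappa> i = 0")
    case True
    then have "BR i = (if v (Suc i) = 0 then {0} else {})" by (auto simp: BR_def)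
    then show ?thesis using True by (simp add: R_def)
  next
    case False
    then have "BR i = {b \<in> {\<kappa> i, \<kappa> i - 1}. v (Suc i) \<le> b \<and> b \<le> v i}"
      by (auto simp: BR_def)
    then have "R i = (\<Sum>b\<in>{\<kappa> i, \<kappa> i - 1}. if v (Suc i) \<le> b \<and> b \<le> v i then t ^ (\<kappa> i - b) else 0)"
      unfolding R_def by (simp only: sum.inter_filter finite.intros)
    also have "\<dots> = (if v (Suc i) \<le> \<kappa> i \<and> \<kappa> i \<le> v i then 1 else 0) +
        (if v (Suc i) \<le> \<kappa> i - 1 \<and> \<kappa> i - 1 \<le> v i then t ^ (\<kappa> i - (\<kappa> i - 1)) else 0)"
      using False by simp
    also have "\<kappa> i - (\<kappa> i - 1) = 1" using False by simp
    also have "v (Suc i) \<le> \<kappa> i - 1 \<and> \<kappa> i - 1 \<le> v i \<longleftrightarrow> v (Suc i) < \<kappa> i \<and> \<kappa> i \<le> Suc (v i)"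
      using False by auto
    finally show ?thesis by simp
  qed
  \<comment> \<open>\<open>c i\<close> is \<open>L i\<close> without the upper bound by
    \<open>\<kappa> (i - 1)\<close>. It is the factor left over when the first i + 1 of the
    \<open>L\<close> are matched with the first i of the \<open>R\<close>. At i = M it equals 1 + t,
    because \<open>\<kappa> M\<close> is 0.\<close>
  define c where "c i = (if Suc (v i) = \<kappa> i then t else if \<kappa> i \<le> v i then 1 + t else 0)" for i
  have step: "R i * c (Suc i) = c i * L (Suc i)" for i
    using vSuc[of i] \<kappa>Suc[of i] by (auto simp: R L c_def)
  have "(\<Prod>i<Suc m. L i) = (\<Prod>i<m. R i) * c m" for m
  proof (induction m)
    case 0 then show ?case by (auto simp: L c_def)
  next
    case (Suc m)
    have "(\<Prod>i<Suc (Suc m). L i) = (\<Prod>i<m. R i) * (c m * L (Suc m))"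
      using Suc by (simp add: mult.assoc)
    then show ?case by (simp add: step[symmetric] mult.assoc)
  qed
  moreover have "c M = 1 + t" using \<kappa>0[of M] by (simp add: c_def)
  ultimately have tele: "(\<Prod>i<Suc M. L i) = (1 + t) * (\<Prod>i<M. R i)" by (simp add: mult.commute)
  have "(\<Sum>l\<in>box (Suc M) BL. t ^ ((\<Sum>i<Suc M. l i) - (\<Sum>i<Suc M. v i))) =
      (\<Sum>l\<in>box (Suc M) BL. \<Prod>i<Suc M. t ^ (l i - v i))"
    by (intro sum.cong refl power_sum_diff) (auto simp: box_def BL_def)
  also have "\<dots> = (\<Prod>i<Suc M. L i)" unfolding L_def by (rule sum_box_prod)
  also have "\<dots> = (1 + t) * (\<Sum>\<mu>\<in>box M BR. \<Prod>i<M. t ^ (\<kappa> i - \<mu> i))"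
    unfolding tele R_def sum_box_prod[where f = "\<lambda>i b. t ^ (\<kappa> i - b)"] ..
  also have "(\<Sum>\<mu>\<in>box M BR. \<Prod>i<M. t ^ (\<kappa> i - \<mu> i)) =
      (\<Sum>\<mu>\<in>box M BR. t ^ ((\<Sum>i<M. \<kappa> i) - (\<Sum>i<M. \<mu> i)))"
    by (intro sum.cong refl power_sum_diff[symmetric]) (auto simp: box_def BR_def)
  finally show ?thesis unfolding setL setR .
qed

text \<open>Splitting off the letter 1 removes the factor 1 + t and scales the remaining letters by
  \<open>w\<close>. The induction hypothesis is therefore needed at t * w, hence the generalisation
  over \<open>t\<close>. The powers of \<open>w\<close> then combine to a function of
  \<open>\<kappa>\<close> alone, and \<open>strips_commute\<close> exchanges adding a strip with
  branching.\<close>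

lemma pieri_gen:
  fixes w t :: "'a::comm_semiring_1"
  assumes "v \<in> par M"
  shows "(\<Prod>i<M. 1 + t * w ^ i) * schur_spec w M v =
    (\<Sum>l\<in>vstrips M v. t ^ ((\<Sum>i<M. l i) - (\<Sum>i<M. v i)) * schur_spec w M l)"
  using assms
proof (induction M arbitrary: v t)
  case 0
  then have "vstrips 0 v = {\<lambda>_. 0}" by (auto simp: vstrips_def par_def)
  then show ?case by simp
next
  case (Suc M)
  let ?S = "\<lambda>M l. (\<Sum>i<M. l i) :: nat"
  \<comment> \<open>A finite set containing every intermediate shape of either order of operations,
    so that the double sums can be exchanged.\<close>
  define K where "K = {\<kappa> \<in> par M. \<forall>i. \<kappa> i \<le> Suc (v i)}"
  have finK: "finite K" unfolding K_def by (rule par_bounded_finite)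
  have "(\<Prod>i<Suc M. 1 + t * w ^ i) = (1 + t) * (\<Prod>i<M. 1 + (t * w) * w ^ i)"
    by (subst prod.lessThan_Suc_shift) (simp add: mult.assoc)
  then have "(\<Prod>i<Suc M. 1 + t * w ^ i) * schur_spec w (Suc M) v =
      (1 + t) * (\<Sum>\<mu>\<in>interlacing M v. w ^ ?S M \<mu> * ((\<Prod>i<M. 1 + (t * w) * w ^ i) * schur_spec w M \<mu>))"
    by (simp add: sum_distrib_left mult_ac)
  also have "(\<Sum>\<mu>\<in>interlacing M v. w ^ ?S M \<mu> * ((\<Prod>i<M. 1 + (t * w) * w ^ i) * schur_spec w M \<mu>)) =
      (\<Sum>\<mu>\<in>interlacing M v. \<Sum>\<kappa>\<in>{\<kappa> \<in> K. \<kappa> \<in> vstrips M \<mu>}. t ^ (?S M \<kappa> - ?S M \<mu>) * (w ^ ?S M \<kappa> * schur_spec w M \<kappa>))"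
  proof (rule sum.cong)
    fix \<mu> assume \<mu>: "\<mu> \<in> interlacing M v"
    have "\<mu> i \<le> v i" for i using \<mu> by (cases "i < M") (auto simp: interlacing_def box_def)
    then have "vstrips M \<mu> \<subseteq> K" unfolding vstrips_def K_def by (fastforce intro: le_trans)
    then have K: "{\<kappa> \<in> K. \<kappa> \<in> vstrips M \<mu>} = vstrips M \<mu>" by auto
    have "w ^ ?S M \<mu> * ((t * w) ^ (?S M \<kappa> - ?S M \<mu>) * schur_spec w M \<kappa>) =
        t ^ (?S M \<kappa> - ?S M \<mu>) * (w ^ ?S M \<kappa> * schur_spec w M \<kappa>)" if "\<kappa> \<in> vstrips M \<mu>" for \<kappa>
    proof -
      have "?S M \<mu> \<le> ?S M \<kappa>" using that by (intro sum_mono) (auto simp: vstrips_def)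
      then have "w ^ ?S M \<kappa> = w ^ ?S M \<mu> * w ^ (?S M \<kappa> - ?S M \<mu>)"
        by (simp add: power_add[symmetric])
      then show ?thesis by (simp add: power_mult_distrib mult_ac)
    qed
    then show "w ^ ?S M \<mu> * ((\<Prod>i<M. 1 + (t * w) * w ^ i) * schur_spec w M \<mu>) =
        (\<Sum>\<kappa>\<in>{\<kappa> \<in> K. \<kappa> \<in> vstrips M \<mu>}. t ^ (?S M \<kappa> - ?S M \<mu>) * (w ^ ?S M \<kappa> * schur_spec w M \<kappa>))"
      unfolding K Suc.IH[OF interlacing_par[OF Suc.prems \<mu>]] sum_distrib_left by (intro sum.cong) auto
  qed simp
  also have "\<dots> = (\<Sum>\<kappa>\<in>K. (\<Sum>\<mu>\<in>{\<mu> \<in> interlacing M v. \<kappa> \<in> vstrips M \<mu>}. t ^ (?S M \<kappa> - ?S M \<mu>)) *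
      (w ^ ?S M \<kappa> * schur_spec w M \<kappa>))"
    by (subst sum.swap_restrict) (simp_all add: finK sum_distrib_right)
  also have "(1 + t) * \<dots> = (\<Sum>\<kappa>\<in>K. (\<Sum>l\<in>{l \<in> vstrips (Suc M) v. \<kappa> \<in> interlacing M l}.
      t ^ (?S (Suc M) l - ?S (Suc M) v)) * (w ^ ?S M \<kappa> * schur_spec w M \<kappa>))"
    by (subst sum_distrib_left, intro sum.cong refl)
      (simp only: strips_commute[OF Suc.prems] K_def mem_Collect_eq mult.assoc)
  also have "\<dots> = (\<Sum>l\<in>vstrips (Suc M) v. \<Sum>\<kappa>\<in>{\<kappa> \<in> K. \<kappa> \<in> interlacing M l}.
      t ^ (?S (Suc M) l - ?S (Suc M) v) * (w ^ ?S M \<kappa> * schur_spec w M \<kappa>))"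
    by (subst sum.swap_restrict) (simp_all add: finK sum_distrib_right del: sum.lessThan_Suc)
  also have "\<dots> = (\<Sum>l\<in>vstrips (Suc M) v. t ^ (?S (Suc M) l - ?S (Suc M) v) * schur_spec w (Suc M) l)"
  proof (rule sum.cong)
    fix l assume l: "l \<in> vstrips (Suc M) v"
    have "\<kappa> \<in> K" if \<kappa>: "\<kappa> \<in> interlacing M l" for \<kappa>
    proof -
      have "\<kappa> \<in> par M" using l \<kappa> by (auto simp: vstrips_def intro: interlacing_par)
      moreover have "\<kappa> i \<le> Suc (v i)" for i
      proof -
        have "\<kappa> i \<le> l i" using \<kappa> by (cases "i < M") (auto simp: interlacing_def box_def)
        also have "l i \<le> Suc (v i)" using l by (simp add: vstrips_def)
        finally show ?thesis .
      qed
      ultimately show ?thesis by (simp add: K_def)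
    qed
    then have "{\<kappa> \<in> K. \<kappa> \<in> interlacing M l} = interlacing M l" by auto
    then show "(\<Sum>\<kappa>\<in>{\<kappa> \<in> K. \<kappa> \<in> interlacing M l}. t ^ (?S (Suc M) l - ?S (Suc M) v) * (w ^ ?S M \<kappa> * schur_spec w M \<kappa>)) =
        t ^ (?S (Suc M) l - ?S (Suc M) v) * schur_spec w (Suc M) l"
      by (simp add: sum_distrib_left del: sum.lessThan_Suc)
  qed simp
  finally show ?case .
qed

text \<open>\<open>e\<^sub>a(1, w, \<dots>, w\<^bsup>M-1\<^esup>)\<close>, read off the generating function.\<close>

definition elem_spec :: "'a::comm_semiring_1 \<Rightarrow> nat \<Rightarrow> nat \<Rightarrow> 'a" where
  "elem_spec w M a = coeff (\<Prod>i<M. [:1, w ^ i:]) a"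

lemma sum_const_poly: "(\<Sum>i\<in>A. [:f i:]) = [:\<Sum>i\<in>A. f i:]"
  by (induction A rule: infinite_finite_induct) auto

lemma const_poly_power: "[:w:] ^ n = [:w ^ n:]" for w :: "'a::comm_semiring_1"
  by (induction n) (auto simp: one_pCons mult.commute)

lemma schur_spec_const: "schur_spec [:w:] M l = [:schur_spec w M l:]" for w :: "'a::comm_semiring_1"
  by (induction M arbitrary: l) (auto simp: one_pCons const_poly_power sum_const_poly[symmetric] mult.commute)

text \<open>The coefficient of t^a in \<open>pieri_gen\<close>, applied over the polynomial ring
  with the variable as t and a constant polynomial as \<open>w\<close>.\<close>

lemma pieri:
  fixes w :: "'a::comm_semiring_1"
  assumes "v \<in> par M"
  shows "elem_spec w M a * schur_spec w M v =
    (\<Sum>l\<in>{l \<in> vstrips M v. (\<Sum>i<M. l i) = (\<Sum>i<M. v i) + a}. schur_spec w M l)"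
proof -
  have "(\<Prod>i<M. 1 + [:0, 1:] * [:w:] ^ i) = (\<Prod>i<M. [:1, w ^ i:])"
    by (intro prod.cong) (auto simp: const_poly_power one_pCons)
  then have "elem_spec w M a * schur_spec w M v =
      coeff ((\<Prod>i<M. 1 + [:0, 1:] * [:w:] ^ i) * schur_spec [:w:] M v) a"
    by (simp add: elem_spec_def schur_spec_const mult.commute)
  also have "\<dots> = (\<Sum>l\<in>vstrips M v. coeff ([:0, 1:] ^ ((\<Sum>i<M. l i) - (\<Sum>i<M. v i)) * [:schur_spec w M l:]) a)"
    
    by (simp only: pieri_gen[OF assms] coeff_sum) (simp only: schur_spec_const)
  also have "\<dots> = (\<Sum>l\<in>vstrips M v. if (\<Sum>i<M. l i) = (\<Sum>i<M. v i) + a then schur_spec w M l else 0)"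
  proof (rule sum.cong)
    fix l assume l: "l \<in> vstrips M v"
    have le: "(\<Sum>i<M. v i) \<le> (\<Sum>i<M. l i)" using l by (intro sum_mono) (auto simp: vstrips_def)
    have "[:0, 1:] ^ n * [:c:] = monom c n" for n and c :: 'a
      by (simp add: monom_altdef[of 1, symmetric, simplified] smult_monom)
    then show "coeff ([:0, 1:] ^ ((\<Sum>i<M. l i) - (\<Sum>i<M. v i)) * [:schur_spec w M l:]) a =
        (if (\<Sum>i<M. l i) = (\<Sum>i<M. v i) + a then schur_spec w M l else 0)"
      using le by auto
  qed simp
  finally show ?thesis by (simp add: sum.inter_filter)
qed

section \<open>Divisibility and nonnegativity\<close>

abbreviation pX :: "int poly" where "pX \<equiv> [:0, 1:]"

definition q_num :: "nat \<Rightarrow> int poly" where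
  "q_num s = (\<Sum>i<s. pX ^ i)"

lemma q_num_0 [simp]: "q_num 0 = 0" by (simp add: q_num_def)

lemma q_num_telescope: "(1 - pX) * q_num s = 1 - pX ^ s"
  by (simp add: q_num_def one_diff_power_eq)

lemma one_minus_pX: "1 - pX \<noteq> 0"
  by (simp add: one_pCons)

lemma q_num_add: "q_num (a + b) = q_num a + pX ^ a * q_num b"
proof -
  have "1 - x * y = 1 - x + x * (1 - y)" for x y :: "int poly" by (simp add: algebra_simps)
  then have "(1 - pX) * q_num (a + b) = (1 - pX) * (q_num a + pX ^ a * q_num b)"
    by (simp only: distrib_left mult.left_commute[of "1 - pX"] q_num_telescope power_add)
  then show ?thesis using one_minus_pX by simp
qed

text \<open>Since \<open>q_num M\<close> is 1 plus a multiple of \<open>pX\<close>, the variable is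
  invertible modulo \<open>q_num M\<close>.\<close>

lemma q_num_dvd_cancel_pX:
  assumes "0 < M" "q_num M dvd pX ^ b * y"
  shows "q_num M dvd y"
  using assms(2)
proof (induction b)
  case (Suc b)
  obtain r where r: "q_num M = 1 + pX * r"
    using q_num_add[of 1 "M - 1"] assms(1) by (auto simp: q_num_def)
  have "pX ^ b * y = q_num M * (pX ^ b * y) - r * (pX ^ Suc b * y)"
    by (simp only: r power_Suc) (simp only: algebra_simps)
  also have "q_num M dvd \<dots>" using Suc.prems by (intro dvd_diff[OF dvd_triv_left dvd_mult])
  finally show ?case by (rule Suc.IH)
qed simp

lemma q_num_dvd_add:
  assumes "q_num M dvd q_num a * p" "q_num M dvd q_num b * p"
  shows "q_num M dvd q_num (a + b) * p"
proof -
  have "q_num (a + b) * p = q_num a * p + pX ^ a * (q_num b * p)"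
    by (simp only: q_num_add distrib_right mult.assoc)
  then show ?thesis using assms by (simp only: dvd_add dvd_mult)
qed

text \<open>Subtractive Euclidean algorithm. By [a + c] = [a] + q^a [c] and the invertibility of q
  modulo [M], the property of \<open>a\<close> that [M] divides [a] p passes to differences.\<close>

lemma q_num_dvd_gcd:
  assumes "0 < M" "q_num M dvd q_num a * p" "q_num M dvd q_num b * p"
  shows "q_num M dvd q_num (gcd a b) * p"
  using assms(2,3)
proof (induction "a + b" arbitrary: a b rule: less_induct)
  case less
  have step: "q_num M dvd q_num c * p" if "q_num M dvd q_num a * p" "q_num M dvd q_num (a + c) * p" for a c
  proof (rule q_num_dvd_cancel_pX[OF assms(1)])
    have "pX ^ a * (q_num c * p) = q_num (a + c) * p - q_num a * p"
      by (simp only: q_num_add distrib_right mult.assoc add_diff_cancel_left')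
    then show "q_num M dvd pX ^ a * (q_num c * p)" using that by (simp only: dvd_diff)
  qed
  consider "a = 0" | "b = 0" | "0 < a" "a \<le> b" | "0 < b" "b < a" by linarith
  then show ?case
  proof cases
    case 3
    then have "q_num M dvd q_num (b - a) * p" using step[of a "b - a"] less.prems by simp
    then have "q_num M dvd q_num (gcd a (b - a)) * p" using 3 less.prems by (intro less.hyps) auto
    moreover have "gcd a (b - a) = gcd a b" using gcd_diff1_nat[OF 3(2)] by (simp add: gcd.commute)
    ultimately show ?thesis by simp
  next
    case 4
    then have "q_num M dvd q_num (a - b) * p" using step[of b "a - b"] less.prems by simp
    then have "q_num M dvd q_num (gcd (a - b) b) * p" using 4 less.prems by (intro less.hyps) auto
    then show ?thesis using 4 by (simp add: gcd_diff1_nat)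
  qed (use less.prems in auto)
qed

lemma coeff_prod_scaled:
  "coeff (\<Prod>i<M. [:1, w * c i:]) a = w ^ a * coeff (\<Prod>i<(M::nat). [:1, c i:]) a" for w :: "'a::comm_semiring_1"
proof (induction M arbitrary: a)
  case (Suc M)
  have *: "coeff (p * [:1, d:]) a = coeff p a + (case a of 0 \<Rightarrow> 0 | Suc b \<Rightarrow> d * coeff p b)"
    for p :: "'a poly" and d a by (subst mult.commute) (auto simp: coeff_pCons split: nat.split)
  show ?case
    by (simp only: prod.lessThan_Suc * Suc) (auto simp: algebra_simps split: nat.split)
qed simp

text \<open>The q-difference equation of the generating function E(y) = \<Prod>(1 + w^i y), namely
  (1 + y) E(w y) = (1 + w^M y) E(y), read at y^(a+1).\<close>

lemma elem_spec_rec: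
  "w ^ Suc a * elem_spec w M (Suc a) + w ^ a * elem_spec w M a =
    elem_spec w M (Suc a) + w ^ M * elem_spec w M a" for w :: "'a::comm_semiring_1"
proof -
  have "(\<Prod>i<M. [:1, w * w ^ i:]) * [:1, 1:] = (\<Prod>i<M. [:1, w ^ i:]) * [:1, w ^ M:]"
    using prod.lessThan_Suc_shift[of "\<lambda>i. [:1, w ^ i:]" M] by (simp add: mult.commute)
  then have "coeff ((\<Prod>i<M. [:1, w * w ^ i:]) * [:1, 1:]) (Suc a) =
      coeff ((\<Prod>i<M. [:1, w ^ i:]) * [:1, w ^ M:]) (Suc a)" by simp
  then show ?thesis
    by (simp add: coeff_prod_scaled elem_spec_def)
qed

text \<open>The recurrence becomes [a + 1] e_(a+1) = ([M] - [a]) e_a, and divisibility passes from a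
  to a + 1.\<close>

lemma q_num_dvd_elem_spec: "q_num M dvd q_num a * elem_spec pX M a"
proof (induction a)
  case (Suc a)
  let ?e = "elem_spec pX M (Suc a)" and ?e' = "elem_spec pX M a"
  have "pX ^ Suc a * ?e + pX ^ a * ?e' = ?e + pX ^ M * ?e'" by (rule elem_spec_rec)
  then have "(1 - pX ^ Suc a) * ?e = (1 - pX ^ M) * ?e' - (1 - pX ^ a) * ?e'"
    by (simp only: left_diff_distrib mult_1 algebra_simps)
  then have "(1 - pX) * (q_num (Suc a) * ?e) = (1 - pX) * (q_num M * ?e' - q_num a * ?e')"
    by (simp only: mult.assoc[symmetric] right_diff_distrib q_num_telescope)
  then have "q_num (Suc a) * ?e = q_num M * ?e' - q_num a * ?e'" using one_minus_pX by simp
  then show ?case using Suc by (simp only: dvd_diff dvd_triv_left)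
qed simp

text \<open>Each factor e_a admits the multiplier [a], and multipliers add up to the total degree.
  As [M] is trivially a multiplier too, the gcd is one.\<close>

lemma q_num_dvd_elem_prod:
  assumes "0 < M"
  shows "q_num M dvd q_num (gcd M (sum_list as)) * prod_list (map (elem_spec pX M) as)"
proof (rule q_num_dvd_gcd[OF assms])
  show "q_num M dvd q_num (sum_list as) * prod_list (map (elem_spec pX M) as)"
  proof (induction as)
    case (Cons a as)
    have "q_num M dvd q_num a * prod_list (map (elem_spec pX M) (a # as))"
      using q_num_dvd_elem_spec[of M a] by (simp add: mult.assoc[symmetric])
    moreover have "q_num M dvd q_num (sum_list as) * prod_list (map (elem_spec pX M) (a # as))"
      using Cons by (simp only: list.map prod_list.Cons mult.left_commute[of _ "elem_spec pX M a"] dvd_mult)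
    ultimately show ?case by (simp add: q_num_dvd_add)
  qed simp
qed simp

lemma schur_spec_zero: "schur_spec w M (\<lambda>_. 0) = 1"
proof (induction M)
  case (Suc M)
  have "interlacing M (\<lambda>_. 0) = {\<lambda>_. 0}" 
    by (auto simp: interlacing_def box_def fun_eq_iff) (metis linorder_not_less)
  then show ?case using Suc by simp
qed simp

text \<open>Makes the Pieri rule triangular, so that it can be solved for the Schur function \<open>v\<close>.\<close>

lemma vstrip_measure_less:
  assumes top: "\<And>i. i < a \<Longrightarrow> v i = Suc (u i)" "\<And>i. a \<le> i \<Longrightarrow> v i = u i"
    and a: "a \<le> M" and l: "l \<in> vstrips M u"
    and size: "(\<Sum>i<M. l i) = (\<Sum>i<M. u i) + a" and ne: "l \<noteq> v"
  shows "(\<Sum>i<M. (M - i) * l i) < (\<Sum>i<M. (M - i) * v i)"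
proof -
  define d where "d i = int (v i) - int (l i)" for i
  have lb: "u i \<le> l i" "l i \<le> Suc (u i)" for i using l by (auto simp: vstrips_def)
  have hi: "0 \<le> d i" if "i < a" for i using top(1)[OF that] lb[of i] by (simp add: d_def)
  have lo: "d i \<le> 0" if "a \<le> i" for i using top(2)[OF that] lb[of i] by (simp add: d_def)
  have "(\<Sum>i<M. v i) = (\<Sum>i<M. u i + (if i < a then 1 else 0))"
    using top by (intro sum.cong) auto
  also have "\<dots> = (\<Sum>i<M. u i) + a"
  proof -
    have "{i \<in> {..<M}. i < a} = {..<a}" using a by auto
    then show ?thesis by (simp add: sum.distrib sum.inter_filter[symmetric])
  qed
  finally have "(\<Sum>i<M. int (v i)) = (\<Sum>i<M. int (l i))" using size by (simp only: of_nat_sum[symmetric])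
  then have d0: "(\<Sum>i<M. d i) = 0" by (simp add: d_def sum_subtractf)
  \<comment> \<open>If the surplus in the first \<open>a\<close> rows were 0, all differences would
    have to vanish, since they have constant sign on each side of row \<open>a\<close>.\<close>
  have pos: "0 < (\<Sum>i<a. d i)"
  proof (rule ccontr)
    assume neg: "\<not> ?thesis"
    have split: "(\<Sum>i<M. d i) = (\<Sum>i<a. d i) + (\<Sum>i\<in>{a..<M}. d i)"
      using a by (metis atLeast0LessThan le0 sum.atLeastLessThan_concat)
    have "(\<Sum>i<a. d i) \<ge> 0" "(\<Sum>i\<in>{a..<M}. d i) \<le> 0"
      using hi lo by (auto intro!: sum_nonneg sum_nonpos)
    with neg d0 split have z: "(\<Sum>i<a. d i) = 0" "(\<Sum>i\<in>{a..<M}. d i) = 0" by auto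
    have "d i = 0" if "i < a" for i
      using z(1) hi that by (subst (asm) sum_nonneg_eq_0_iff) auto
    moreover have "d i = 0" if "a \<le> i" "i < M" for i
    proof -
      have "(\<Sum>i\<in>{a..<M}. - d i) = 0" using z(2) by (simp add: sum_negf)
      then show ?thesis using lo that by (subst (asm) sum_nonneg_eq_0_iff) auto
    qed
    moreover have "d i = 0" if "M \<le> i" for i
      using that a top(2)[of i] lo[of i] lb[of i] l by (auto simp: d_def vstrips_def par_def)
    ultimately have "d i = 0" for i by (metis not_le)
    then have "l = v" by (auto simp: d_def fun_eq_iff)
    with ne show False by simp
  qed
  \<comment> \<open>The weight M - i exceeds M - a by at least 1 where \<open>d i\<close> may be
    positive and is at most M - a where it may be negative. As the \<open>d i\<close> sum to 0, the
    constant weight M - a drops out and the surplus remains.\<close>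
  have "(\<Sum>i<M. (int M - int a) * d i + (if i < a then d i else 0)) \<le> (\<Sum>i<M. (int M - int i) * d i)"
  proof (rule sum_mono)
    fix i assume "i \<in> {..<M}"
    show "(int M - int a) * d i + (if i < a then d i else 0) \<le> (int M - int i) * d i"
    proof (cases "i < a")
      case True
      then have "(int M - int a + 1) * d i \<le> (int M - int i) * d i"
        using hi by (intro mult_right_mono) auto
      then show ?thesis using True by (simp add: algebra_simps)
    next
      case False
      then show ?thesis using lo[of i] by (auto intro: mult_right_mono_neg)
    qed
  qed
  moreover have "(\<Sum>i<M. (int M - int a) * d i + (if i < a then d i else 0)) = (\<Sum>i<a. d i)"
  proof -
    have "{i \<in> {..<M}. i < a} = {..<a}" using a by auto
    then show ?thesis by (simp add: sum.distrib sum_distrib_left[symmetric] d0 sum.inter_filter[symmetric])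
  qed
  moreover have "(\<Sum>i<M. (int M - int i) * d i) =
      int (\<Sum>i<M. (M - i) * v i) - int (\<Sum>i<M. (M - i) * l i)"
    by (simp add: d_def right_diff_distrib sum_subtractf of_nat_diff)
  ultimately have "0 < int (\<Sum>i<M. (M - i) * v i) - int (\<Sum>i<M. (M - i) * l i)"
    using pos by simp
  then show ?thesis by (simp only: diff_gt_0_iff_gt of_nat_less_iff)
qed

text \<open>Expresses a Schur polynomial through products of elementary ones by solving the Pieri
  rule for its leading term. Carrying the list \<open>as\<close> gives both replacement terms the
  same form: one has an additional elementary factor and a smaller shape, the others a shape of
  smaller measure. The total degree, hence the gcd, stays the same.\<close>

lemma q_num_dvd_elem_prod_schur_spec:
  assumes M: "0 < M" and v: "v \<in> par M"
  shows "q_num M dvd q_num (gcd M (sum_list as + (\<Sum>i<M. v i))) *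
    (prod_list (map (elem_spec pX M) as) * schur_spec pX M v)"
  using v
proof (induction "\<Sum>i<M. (M - i) * v i" arbitrary: v as rule: less_induct)
  case less
  show ?case
  proof (cases "v 0 = 0")
    case True
    then have "v = (\<lambda>_. 0)" using par_antimono[OF less.prems] by (metis le0 le_zero_eq)
    then show ?thesis using q_num_dvd_elem_prod[OF M] by (simp add: schur_spec_zero)
  next
    case False
    \<comment> \<open>The number of rows of maximal length, that is, the height of the last column;
      \<open>u\<close> is \<open>v\<close> with this column removed.\<close>
    define a where "a = (LEAST i. v i \<noteq> v 0)"
    have "v M \<noteq> v 0" using less.prems False by (simp add: par_def)
    then have a: "v a \<noteq> v 0" "a \<le> M" 
      unfolding a_def by (metis (mono_tags, lifting) LeastI, metis (mono_tags, lifting) Least_le)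
    have lt: "v i = v 0" if "i < a" for i using that not_less_Least unfolding a_def by blast
    have ge: "v i < v 0" if "a \<le> i" for i
      using par_antimono[OF less.prems that] par_antimono[OF less.prems, of 0 a] a(1) by linarith
    define u where "u i = (if i < a then v i - 1 else v i)" for i
    have pos: "0 < v i" if "i < a" for i using lt[OF that] False by simp
    then have top: "\<And>i. i < a \<Longrightarrow> v i = Suc (u i)" "\<And>i. a \<le> i \<Longrightarrow> v i = u i"
      by (auto simp: u_def)
    have a0: "0 < a" using a(1) by (cases a) auto
    have u: "u \<in> par M"
    proof -
      have "u (Suc i) \<le> u i" for i
      proof -
        have "v (Suc i) \<le> v i" using less.prems by (auto simp: par_def)
        moreover have "v (Suc i) < v 0" if "\<not> Suc i < a" using ge that by simp
        ultimately show ?thesis using lt[of i] by (auto simp: u_def)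
      qed
      then show ?thesis using less.prems by (auto simp: par_def u_def)
    qed
    have vu: "v \<in> vstrips M u" using less.prems by (auto simp: vstrips_def u_def)
    have sz: "(\<Sum>i<M. v i) = (\<Sum>i<M. u i) + a"
    proof -
      have "(\<Sum>i<M. v i) = (\<Sum>i<M. u i + (if i < a then 1 else 0))"
        using top by (intro sum.cong) auto
      moreover have "{i \<in> {..<M}. i < a} = {..<a}" using a(2) by auto
      ultimately show ?thesis by (simp add: sum.distrib sum.inter_filter[symmetric])
    qed
    let ?V = "{l \<in> vstrips M u. (\<Sum>i<M. l i) = (\<Sum>i<M. u i) + a}"
    let ?e = "\<lambda>as. prod_list (map (elem_spec pX M) as)"
    let ?k = "q_num (gcd M (sum_list as + (\<Sum>i<M. v i)))"
    have ml: "(\<Sum>i<M. (M - i) * l i) < (\<Sum>i<M. (M - i) * v i)" if "l \<in> ?V - {v}" for l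
      using that by (intro vstrip_measure_less[OF top a(2)]) auto
    have mu: "(\<Sum>i<M. (M - i) * u i) < (\<Sum>i<M. (M - i) * v i)"
    proof (rule sum_strict_mono_ex1)
      show "\<forall>i\<in>{..<M}. (M - i) * u i \<le> (M - i) * v i" by (auto simp: u_def)
      show "\<exists>i\<in>{..<M}. (M - i) * u i < (M - i) * v i"
        using a0 M False by (intro bexI[of _ 0]) (auto simp: u_def)
    qed simp
    have "elem_spec pX M a * schur_spec pX M u =
        schur_spec pX M v + (\<Sum>l\<in>?V - {v}. schur_spec pX M l)"
      unfolding pieri[OF u] using vu sz by (intro sum.remove) auto
    then have "schur_spec pX M v = elem_spec pX M a * schur_spec pX M u - (\<Sum>l\<in>?V - {v}. schur_spec pX M l)"
      by simp
    then have eq: "?k * (?e as * schur_spec pX M v) =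
        ?k * (?e (a # as) * schur_spec pX M u) - (\<Sum>l\<in>?V - {v}. ?k * (?e as * schur_spec pX M l))"
      by (simp only: right_diff_distrib sum_distrib_left list.map prod_list.Cons mult_ac)
    have "q_num M dvd ?k * (?e (a # as) * schur_spec pX M u)"
      using less.hyps[OF mu u, of "a # as"] sz by (simp add: ac_simps)
    moreover have "q_num M dvd (\<Sum>l\<in>?V - {v}. ?k * (?e as * schur_spec pX M l))"
    proof (rule dvd_sum)
      fix l assume l: "l \<in> ?V - {v}"
      then have "l \<in> par M" "(\<Sum>i<M. l i) = (\<Sum>i<M. v i)" using sz by (auto simp: vstrips_def)
      then show "q_num M dvd ?k * (?e as * schur_spec pX M l)"
        using less.hyps[OF ml[OF l], of as] by simp
    qed
    ultimately show ?thesis unfolding eq by (rule dvd_diff)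
  qed
qed

lemma q_num_dvd_schur_spec:
  assumes "0 < M" "v \<in> par M"
  shows "q_num M dvd q_num (gcd M (\<Sum>i<M. v i)) * schur_spec pX M v"
  using q_num_dvd_elem_prod_schur_spec[OF assms, of "[]"] by simp

section \<open>Nonnegativity of the quotient\<close>

lemma coeff_one_minus_pX_power:
  "coeff ((1 - pX ^ n) * p) i = coeff p i - (if n \<le> i then coeff p (i - n) else 0)"
  by (simp add: left_diff_distrib monom_altdef[of 1, symmetric, simplified] coeff_monom_mult)

text \<open>\<open>p\<close> satisfies \<open>p\<^sub>i - p\<^bsub>i-M\<^esub> = f\<^sub>i - f\<^bsub>i-k\<^esub>\<close>.  Below the centre of \<open>f\<close> the right-hand side is
  nonnegative and one argues upwards from degree 0; above it one argues downwards from the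
  degree of \<open>p\<close>.\<close>

lemma unimodal_quotient_nonneg:
  fixes f p :: "int poly"
  assumes eq: "q_num k * f = q_num M * p" and kM: "k \<le> M" "0 < M"
    and nonneg: "\<And>i. 0 \<le> coeff f i"
    and up: "\<And>i. 2 * i < D \<Longrightarrow> coeff f i \<le> coeff f (Suc i)"
    and down: "\<And>i. D < 2 * i \<Longrightarrow> coeff f i \<le> coeff f (i - 1)"
  shows "0 \<le> coeff p i"
proof -
  have "(1 - pX ^ k) * f = (1 - pX ^ M) * p"
    using arg_cong[OF eq, of "(*) (1 - pX)"] by (simp only: mult.assoc[symmetric] q_num_telescope)
  then have rec: "coeff p i - (if M \<le> i then coeff p (i - M) else 0) =
      coeff f i - (if k \<le> i then coeff f (i - k) else 0)" for i
    by (metis coeff_one_minus_pX_power)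
  \<comment> \<open>A chain ending in j uses \<open>up\<close> only as far as j - 1, so j may exceed
    the range of \<open>up\<close> by one. Every degree outside this range satisfies the bound in
    \<open>decr\<close>.\<close>
  have incr: "coeff f i \<le> coeff f j" if "i \<le> j" "2 * j < D + 2" for i j
    using that by (induction j rule: dec_induct) (auto intro: order_trans up)
  have decr: "coeff f j \<le> coeff f i" if "i \<le> j" "D < 2 * (i + 1)" for i j
    using that
  proof (induction j rule: dec_induct)
    case (step n)
    then show ?case using down[of "Suc n"] by auto
  qed simp
  show ?thesis
  proof (cases "2 * i < D + 2")
    case True
    then show ?thesis
    proof (induction i rule: less_induct)
      case (less i)
      have "0 \<le> coeff f i - (if k \<le> i then coeff f (i - k) else 0)"
        using incr[of "i - k" i] less.prems nonneg by auto
      moreover have "0 \<le> (if M \<le> i then coeff p (i - M) else 0)"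
        using less kM(2) by auto
      ultimately show ?case using rec[of i] by linarith
    qed
  next
    case False
    then show ?thesis
    proof (induction "degree p + 1 - i" arbitrary: i rule: less_induct)
      case less
      show ?case
      proof (cases "degree p < i")
        case True then show ?thesis by (simp add: coeff_eq_0)
      next
        case False
        \<comment> \<open>Read at i + M, the recurrence gives p_i as p_(i+M) minus a difference of
          f. As k is at most M, both indices of that difference are at least i, in the decreasing
          range, so it is not positive.\<close>
        have "0 \<le> coeff p (i + M)" using False less.prems kM(2) by (intro less.hyps) auto
        moreover have "coeff f (i + M) \<le> coeff f (i + M - k)"
          using less.prems kM by (intro decr) auto
        moreover have "coeff p (i + M) - coeff p i = coeff f (i + M) - coeff f (i + M - k)"
          using rec[of "i + M"] kM(1) by simp
        ultimately show ?thesis by simp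
      qed
    qed
  qed
qed

lemma schur_spec_quotient:
  assumes M: "0 < M" and v: "v \<in> par M"
  obtains p where "q_num (gcd M (\<Sum>i<M. v i)) * schur_spec pX M v = q_num M * p" "\<And>i. 0 \<le> coeff p i"
proof -
  obtain p where p: "q_num (gcd M (\<Sum>i<M. v i)) * schur_spec pX M v = q_num M * p"
    using q_num_dvd_schur_spec[OF assms] by (elim dvdE)
  have "0 \<le> coeff p i" for i
  proof (rule unimodal_quotient_nonneg[OF p])
    show "gcd M (\<Sum>i<M. v i) \<le> M" using M by (intro dvd_imp_le) auto
    fix i
    show "2 * i < (M - 1) * (\<Sum>i<M. v i) \<Longrightarrow> coeff (schur_spec pX M v) i \<le> coeff (schur_spec pX M v) (Suc i)"
      "(M - 1) * (\<Sum>i<M. v i) < 2 * i \<Longrightarrow> coeff (schur_spec pX M v) i \<le> coeff (schur_spec pX M v) (i - 1)"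
      using gt_unimodal[OF M, where l = v and j = i] by (simp_all add: coeff_schur_spec)
  qed (use M in \<open>auto simp: coeff_schur_spec\<close>)
  with p that show ?thesis by blast
qed

section \<open>Tableaux and the dual Cauchy identity\<close>

text \<open>(i, j) is row i, column j, and \<open>v\<close> lists column lengths. With
  \<open>v\<close> in \<open>par M\<close> there are at most M columns, and a vertical strip added
  to \<open>v\<close> as a sequence is a horizontal strip of the diagram.\<close>

definition cells :: "(nat \<Rightarrow> nat) \<Rightarrow> (nat \<times> nat) set" where
  "cells v = {(i, j). i < v j}"

text \<open>Semistandard tableaux as functions on the cells of the diagram with column lengths \<open>v\<close>.\<close>

definition tableaux :: "(nat \<Rightarrow> nat) \<Rightarrow> nat \<Rightarrow> (nat \<Rightarrow> nat) \<Rightarrow> (nat \<times> nat \<Rightarrow> nat) set" where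
  "tableaux v L \<alpha> = {t. (\<forall>p. p \<notin> cells v \<longrightarrow> t p = 0) \<and> (\<forall>p\<in>cells v. t p < L) \<and>
     (\<forall>i j. (i, Suc j) \<in> cells v \<longrightarrow> t (i, j) \<le> t (i, Suc j)) \<and>
     (\<forall>i j. (Suc i, j) \<in> cells v \<longrightarrow> t (i, j) < t (Suc i, j)) \<and>
     (\<forall>c<L. card {p \<in> cells v. t p = c} = \<alpha> c)}"

definition par_of_size :: "nat \<Rightarrow> nat \<Rightarrow> (nat \<Rightarrow> nat) set" where
  "par_of_size M N = {v \<in> par M. (\<Sum>j<M. v j) = N}"

lemma finite_par_of_size: "finite (par_of_size M N)"
proof (rule finite_subset[OF _ par_bounded_finite[of M "\<lambda>_. N"]])
  have "v i \<le> N" if "v \<in> par_of_size M N" for v i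
    using that member_le_sum[of i "{..<M}" v] by (cases "i < M") (auto simp: par_of_size_def par_def)
  then show "par_of_size M N \<subseteq> {l \<in> par M. \<forall>i. l i \<le> N}" by (auto simp: par_of_size_def)
qed

lemma cells_eq_Sigma: "v \<in> par M \<Longrightarrow> cells v = (\<lambda>(j, i). (i, j)) ` Sigma {..<M} (\<lambda>j. {..<v j})"
  by (force simp: cells_def par_def image_iff not_le[symmetric])

lemma card_cells: "v \<in> par M \<Longrightarrow> card (cells v) = (\<Sum>j<M. v j)"
  unfolding cells_eq_Sigma by (subst card_image) (auto simp: inj_on_def)

lemma finite_cells: "v \<in> par M \<Longrightarrow> finite (cells v)"
  unfolding cells_eq_Sigma by auto

lemma finite_tableaux:
  assumes "v \<in> par M"
  shows "finite (tableaux v L \<alpha>)"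
proof (rule finite_subset[OF _ finite_set_of_finite_funs[OF finite_cells[OF assms] finite_lessThan[of L], of 0]])
qed (auto simp: tableaux_def)

lemma tableaux_size:
  assumes "v \<in> par M" "t \<in> tableaux v L \<alpha>"
  shows "(\<Sum>j<M. v j) = (\<Sum>c<L. \<alpha> c)"
proof -
  have "cells v = (\<Union>c<L. {p \<in> cells v. t p = c})" using assms(2) by (auto simp: tableaux_def)
  then have "card (cells v) = (\<Sum>c<L. card {p \<in> cells v. t p = c})"
    using finite_cells[OF assms(1)] by (subst card_UN_disjoint[symmetric]) auto
  then show ?thesis using assms by (simp add: card_cells tableaux_def)
qed

text \<open>Columns increase strictly, so the largest letter \<open>L\<close> can occupy only the
  bottom cell of a column; removing it shortens each column by at most 1. The deleted cells receive
  the default 0 required off the diagram.\<close>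

definition remove_letter :: "(nat \<Rightarrow> nat) \<Rightarrow> nat \<Rightarrow> (nat \<times> nat \<Rightarrow> nat) \<Rightarrow> (nat \<Rightarrow> nat) \<times> (nat \<times> nat \<Rightarrow> nat)" where
  "remove_letter v L t =
    (\<lambda>j. if 0 < v j \<and> t (v j - 1, j) = L then v j - 1 else v j, \<lambda>p. if t p < L then t p else 0)"

definition add_letter :: "(nat \<Rightarrow> nat) \<Rightarrow> nat \<Rightarrow> (nat \<Rightarrow> nat) \<times> (nat \<times> nat \<Rightarrow> nat) \<Rightarrow> nat \<times> nat \<Rightarrow> nat" where
  "add_letter v L = (\<lambda>(u, s) p. if p \<in> cells v \<and> p \<notin> cells u then L else s p)"

lemma remove_letter_cells:
  assumes "t \<in> tableaux v (Suc L) \<alpha>"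
  shows "p \<in> cells (fst (remove_letter v L t)) \<longleftrightarrow> p \<in> cells v \<and> t p < L"
proof -
  obtain i j where p: "p = (i, j)" by (cases p)
  have le: "t (i, j) \<le> L" if "i < v j" for i
    using assms that by (auto simp: tableaux_def cells_def less_Suc_eq_le)
  have "t (i, j) < L" if "Suc i < v j"
  proof -
    have "t (i, j) < t (Suc i, j)" using assms that by (auto simp: tableaux_def cells_def)
    with le[OF that] show ?thesis by simp
  qed
  moreover have "t (i, j) < L \<longleftrightarrow> t (i, j) \<noteq> L" if "i < v j" using le[OF that] by auto
  moreover have "Suc i < v j \<or> v j = Suc i \<or> v j \<le> i" by linarith
  ultimately show ?thesis unfolding p by (auto simp: remove_letter_def cells_def)
qed

text \<open>The cells of the largest letter form a horizontal strip, which in column lengths is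
  exactly the relation \<open>vstrips\<close> of the Pieri rule. The inverse fills the added cells
  with \<open>L\<close>.\<close>

lemma tableaux_Suc_bij:
  assumes v: "v \<in> par M"
  shows "bij_betw (remove_letter v L) (tableaux v (Suc L) \<alpha>)
    (Sigma {u \<in> par M. v \<in> vstrips M u \<and> (\<Sum>j<M. v j) = (\<Sum>j<M. u j) + \<alpha> L} (\<lambda>u. tableaux u L \<alpha>))"
    (is "bij_betw _ ?T (Sigma ?U _)")
proof (rule bij_betw_byWitness[where f' = "add_letter v L"])
  have vmono: "v (Suc j) \<le> v j" for j using v by (simp add: par_def)
  show "\<forall>t\<in>?T. add_letter v L (remove_letter v L t) = t"
  proof
    fix t assume t: "t \<in> ?T"
    obtain u s where us: "remove_letter v L t = (u, s)" by fastforce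
    have s: "s p = (if t p < L then t p else 0)" for p using us by (auto simp: remove_letter_def)
    show "add_letter v L (remove_letter v L t) = t"
    proof
      fix p
      have "p \<in> cells v \<Longrightarrow> t p \<le> L" using t by (auto simp: tableaux_def less_Suc_eq_le)
      moreover have "p \<notin> cells v \<Longrightarrow> t p = 0" using t unfolding tableaux_def by blast
      ultimately show "add_letter v L (remove_letter v L t) p = t p"
        using remove_letter_cells[OF t, of p] by (auto simp: us add_letter_def s)
    qed
  qed
  have sub: "cells u \<subseteq> cells v" if "v \<in> vstrips M u" for u
    using that by (auto simp: cells_def vstrips_def intro: less_le_trans)
  show "\<forall>a\<in>Sigma ?U (\<lambda>u. tableaux u L \<alpha>). remove_letter v L (add_letter v L a) = a"
  proof clarify
    fix u s assume u: "u \<in> par M" "v \<in> vstrips M u" and s: "s \<in> tableaux u L \<alpha>"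
    have "(if 0 < v j \<and> add_letter v L (u, s) (v j - 1, j) = L then v j - 1 else v j) = u j" for j
    proof -
      have "u j \<le> v j" "v j \<le> Suc (u j)" using u by (auto simp: vstrips_def)
      moreover have "s (v j - 1, j) < L" if "v j - 1 < u j" using s that by (auto simp: tableaux_def cells_def)
      ultimately show ?thesis by (auto simp: add_letter_def cells_def)
    qed
    moreover have "(if add_letter v L (u, s) p < L then add_letter v L (u, s) p else 0) = s p" for p
    proof -
      have "p \<notin> cells u \<Longrightarrow> s p = 0" "p \<in> cells u \<Longrightarrow> s p < L"
        using s unfolding tableaux_def by blast+
      then show ?thesis using sub[OF u(2)] by (auto simp: add_letter_def)
    qed
    ultimately show "remove_letter v L (add_letter v L (u, s)) = (u, s)"
      by (simp add: remove_letter_def)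
  qed
  show "remove_letter v L ` ?T \<subseteq> Sigma ?U (\<lambda>u. tableaux u L \<alpha>)"
  proof (rule image_subsetI)
    fix t assume t: "t \<in> ?T"
    define u where "u = fst (remove_letter v L t)"
    define s where "s = snd (remove_letter v L t)"
    have s: "s p = (if t p < L then t p else 0)" for p by (auto simp: s_def remove_letter_def)
    have c: "p \<in> cells u \<longleftrightarrow> p \<in> cells v \<and> t p < L" for p
      unfolding u_def by (rule remove_letter_cells[OF t])
    have uv: "u j \<le> v j" "v j \<le> Suc (u j)" for j by (auto simp: u_def remove_letter_def)
    have row: "t (i, j) \<le> t (i, Suc j)" if "(i, Suc j) \<in> cells v" for i j
      using t that by (auto simp: tableaux_def)
    have col: "t (i, j) < t (Suc i, j)" if "(Suc i, j) \<in> cells v" for i j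
      using t that by (auto simp: tableaux_def)
    have "u (Suc j) \<le> u j" for j
    proof (rule ccontr)
      assume "\<not> ?thesis"
      then have "(u j, Suc j) \<in> cells u" by (simp add: cells_def)
      then have A: "(u j, Suc j) \<in> cells v" "t (u j, Suc j) < L" using c by auto
      then have "(u j, j) \<in> cells v" "t (u j, j) < L"
        using vmono[of j] row[OF A(1)] by (auto simp: cells_def)
      then have "(u j, j) \<in> cells u" using c by simp
      then show False by (simp add: cells_def)
    qed
    then have u: "u \<in> par M" using v uv(1) by (auto simp: par_def) (metis le_zero_eq)
    have vu: "v \<in> vstrips M u" using v uv by (simp add: vstrips_def)
    have "cells v = cells u \<union> {p \<in> cells v. t p = L}" "cells u \<inter> {p \<in> cells v. t p = L} = {}"
      using c t by (auto simp: tableaux_def less_Suc_eq)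
    then have "card (cells v) = card (cells u) + card {p \<in> cells v. t p = L}"
      using finite_cells[OF u] finite_cells[OF v] by (metis (no_types, lifting) card_Un_disjoint finite_Un)
    then have size: "(\<Sum>j<M. v j) = (\<Sum>j<M. u j) + \<alpha> L"
      using t by (simp add: card_cells[OF u] card_cells[OF v] tableaux_def)
    have cnt: "{p \<in> cells u. s p = d} = {p \<in> cells v. t p = d}" if "d < L" for d
      using that c s by auto
    have s0: "s p = 0" if "p \<notin> cells u" for p
    proof -
      have "p \<notin> cells v \<Longrightarrow> t p = 0" using t unfolding tableaux_def by blast
      then show ?thesis using that c[of p] s[of p] by auto
    qed
    have row': "s (i, j) \<le> s (i, Suc j)" if "(i, Suc j) \<in> cells u" for i j
      using that c row[of i j] s by auto
    have col': "s (i, j) < s (Suc i, j)" if "(Suc i, j) \<in> cells u" for i j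
      using that c col[of i j] s by auto
    have "s \<in> tableaux u L \<alpha>"
      unfolding tableaux_def
    proof (intro CollectI conjI allI ballI impI)
      fix p assume "p \<in> cells u" then show "s p < L" using c s by auto
    next
      fix d assume d: "d < L"
      then show "card {p \<in> cells u. s p = d} = \<alpha> d" using t unfolding cnt[OF d] by (auto simp: tableaux_def)
    qed (use s0 row' col' in auto)
    then show "remove_letter v L t \<in> Sigma ?U (\<lambda>u. tableaux u L \<alpha>)"
      using u vu size by (simp add: u_def s_def mem_Times_iff Sigma_def prod_eq_iff) 
  qed
  show "add_letter v L ` Sigma ?U (\<lambda>u. tableaux u L \<alpha>) \<subseteq> ?T"
  proof (rule image_subsetI, clarify)
    fix u s assume u: "u \<in> par M" "v \<in> vstrips M u" and size: "(\<Sum>j<M. v j) = (\<Sum>j<M. u j) + \<alpha> L"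
      and s: "s \<in> tableaux u L \<alpha>"
    define t where "t = add_letter v L (u, s)"
    have t: "t p = (if p \<in> cells v \<and> p \<notin> cells u then L else s p)" for p by (simp add: t_def add_letter_def)
    note sub = sub[OF u(2)]
    have sL: "s p < L" if "p \<in> cells u" for p using s that by (auto simp: tableaux_def)
    have srow: "s (i, j) \<le> s (i, Suc j)" if "(i, Suc j) \<in> cells u" for i j
      using s that by (auto simp: tableaux_def)
    have scol: "s (i, j) < s (Suc i, j)" if "(Suc i, j) \<in> cells u" for i j
      using s that by (auto simp: tableaux_def)
    have umono: "u (Suc j) \<le> u j" for j using u by (simp add: par_def)
    have uv: "u j \<le> v j" "v j \<le> Suc (u j)" for j using u by (auto simp: vstrips_def)
    have tL: "t p \<le> L" if "p \<in> cells v" for p using sL[of p] that by (auto simp: t)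
    show "add_letter v L (u, s) \<in> ?T"
      unfolding t_def[symmetric] tableaux_def
    proof (intro CollectI conjI allI ballI impI)
      fix p assume "p \<notin> cells v"
      moreover from this have "s p = 0" using s sub unfolding tableaux_def by blast
      ultimately show "t p = 0" by (simp add: t)
    next
      fix p assume "p \<in> cells v" then show "t p < Suc L" using tL by (simp add: less_Suc_eq_le)
    next
      fix i j assume A: "(i, Suc j) \<in> cells v"
      show "t (i, j) \<le> t (i, Suc j)"
      proof (cases "(i, Suc j) \<in> cells u")
        case True
        then have "(i, j) \<in> cells u" using umono[of j] by (simp add: cells_def)
        then show ?thesis using True srow by (simp add: t)
      next
        case False
        then have "t (i, Suc j) = L" using A by (simp add: t)
        moreover have "(i, j) \<in> cells v" using A vmono[of j] by (simp add: cells_def)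
        ultimately show ?thesis using tL by simp
      qed
    next
      fix i j assume A: "(Suc i, j) \<in> cells v"
      have I: "(i, j) \<in> cells u" using A uv(2)[of j] by (simp add: cells_def)
      show "t (i, j) < t (Suc i, j)"
        using scol[of i j] sL[OF I] I A by (auto simp: t)
    next
      fix d assume d: "d < Suc L"
      show "card {p \<in> cells v. t p = d} = \<alpha> d"
      proof (cases "d < L")
        case True
        then have "{p \<in> cells v. t p = d} = {p \<in> cells u. s p = d}" using sub by (auto simp: t)
        then show ?thesis using s True by (simp add: tableaux_def)
      next
        case False
        then have "d = L" using d by simp
        then have "{p \<in> cells v. t p = d} = cells v - cells u" using sL by (force simp: t)
        then show ?thesis
          using card_Diff_subset[OF finite_cells[OF u(1)] sub] size \<open>d = L\<close>
          by (simp add: card_cells[OF u(1)] card_cells[OF v])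
      qed
    qed
  qed
qed

lemma card_tableaux_Suc:
  assumes v: "v \<in> par M"
  shows "card (tableaux v (Suc L) \<alpha>) =
    (\<Sum>u\<in>{u \<in> par M. v \<in> vstrips M u \<and> (\<Sum>j<M. v j) = (\<Sum>j<M. u j) + \<alpha> L}. card (tableaux u L \<alpha>))"
proof -
  have "finite {u \<in> par M. v \<in> vstrips M u \<and> (\<Sum>j<M. v j) = (\<Sum>j<M. u j) + \<alpha> L}"
    by (rule finite_subset[OF _ par_bounded_finite[of M v]]) (auto simp: vstrips_def)
  then show ?thesis
    unfolding bij_betw_same_card[OF tableaux_Suc_bij[OF v]]
    by (intro card_SigmaI) (auto simp: finite_tableaux)
qed

text \<open>Dual Cauchy identity, from iterating the Pieri rule.\<close>

lemma elem_spec_prod: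
  fixes w :: "'a::comm_semiring_1"
  shows "(\<Prod>c<L. elem_spec w M (\<alpha> c)) =
    (\<Sum>v\<in>par_of_size M (\<Sum>c<L. \<alpha> c). of_nat (card (tableaux v L \<alpha>)) * schur_spec w M v)"
proof (induction L)
  case 0
  have "par_of_size M 0 = {\<lambda>_. 0}"
    by (auto simp: par_of_size_def par_def fun_eq_iff) (metis lessThan_iff not_le)
  moreover have "tableaux (\<lambda>_. 0) 0 \<alpha> = {\<lambda>_. 0}" by (auto simp: tableaux_def cells_def)
  ultimately show ?case by (simp add: schur_spec_zero)
next
  case (Suc L)
  let ?N = "\<Sum>c<L. \<alpha> c"
  have "(\<Prod>c<Suc L. elem_spec w M (\<alpha> c)) =
      (\<Sum>u\<in>par_of_size M ?N. of_nat (card (tableaux u L \<alpha>)) * (elem_spec w M (\<alpha> L) * schur_spec w M u))"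
    by (simp add: Suc sum_distrib_left mult_ac)
  also have "\<dots> = (\<Sum>u\<in>par_of_size M ?N. \<Sum>v\<in>{v \<in> par_of_size M (?N + \<alpha> L). v \<in> vstrips M u}.
      of_nat (card (tableaux u L \<alpha>)) * schur_spec w M v)"
  proof (rule sum.cong)
    fix u assume u: "u \<in> par_of_size M ?N"
    then have "{v \<in> par_of_size M (?N + \<alpha> L). v \<in> vstrips M u} =
        {l \<in> vstrips M u. (\<Sum>i<M. l i) = (\<Sum>i<M. u i) + \<alpha> L}"
      by (auto simp: par_of_size_def vstrips_def)
    then show "of_nat (card (tableaux u L \<alpha>)) * (elem_spec w M (\<alpha> L) * schur_spec w M u) =
      (\<Sum>v\<in>{v \<in> par_of_size M (?N + \<alpha> L). v \<in> vstrips M u}. of_nat (card (tableaux u L \<alpha>)) * schur_spec w M v)"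
      using u by (simp add: pieri par_of_size_def sum_distrib_left)
  qed simp
  also have "\<dots> = (\<Sum>v\<in>par_of_size M (?N + \<alpha> L). \<Sum>u\<in>{u \<in> par_of_size M ?N. v \<in> vstrips M u}.
      of_nat (card (tableaux u L \<alpha>)) * schur_spec w M v)"
    by (rule sum.swap_restrict) (simp_all add: finite_par_of_size)
  also have "\<dots> = (\<Sum>v\<in>par_of_size M (?N + \<alpha> L). of_nat (card (tableaux v (Suc L) \<alpha>)) * schur_spec w M v)"
  proof (rule sum.cong)
    fix v assume v: "v \<in> par_of_size M (?N + \<alpha> L)"
    then have "{u \<in> par_of_size M ?N. v \<in> vstrips M u} =
        {u \<in> par M. v \<in> vstrips M u \<and> (\<Sum>j<M. v j) = (\<Sum>j<M. u j) + \<alpha> L}"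
      by (auto simp: par_of_size_def)
    then show "(\<Sum>u\<in>{u \<in> par_of_size M ?N. v \<in> vstrips M u}. of_nat (card (tableaux u L \<alpha>)) * schur_spec w M v) =
      of_nat (card (tableaux v (Suc L) \<alpha>)) * schur_spec w M v"
      using v by (simp add: card_tableaux_Suc[of v M] par_of_size_def sum_distrib_right)
  qed simp
  finally show ?case by simp
qed

section \<open>Partitions, tableaux as lists, and the plethysm\<close>

definition col_lengths :: "nat list \<Rightarrow> nat \<Rightarrow> nat" where
  "col_lengths \<mu> j = card {i. i < length \<mu> \<and> j < \<mu> ! i}"

lemma downward_closed_card:
  fixes S :: "nat set"
  assumes "finite S" and down: "\<And>i j. i \<le> j \<Longrightarrow> j \<in> S \<Longrightarrow> i \<in> S"
  shows "i \<in> S \<longleftrightarrow> i < card S"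
proof
  assume "i \<in> S"
  then have "{..i} \<subseteq> S" using down by auto
  then have "card {..i} \<le> card S" using assms(1) by (rule card_mono[rotated])
  then show "i < card S" by simp
next
  assume "i < card S"
  show "i \<in> S"
  proof (rule ccontr)
    assume "i \<notin> S"
    then have "S \<subseteq> {..<i}" using down by (meson lessThan_iff not_le subsetI)
    then have "card S \<le> card {..<i}" by (intro card_mono) auto
    with \<open>i < card S\<close> show False by simp
  qed
qed

lemma less_col_lengths:
  assumes "sorted_wrt (\<ge>) \<mu>"
  shows "i < col_lengths \<mu> j \<longleftrightarrow> i < length \<mu> \<and> j < \<mu> ! i"
proof -
  have "\<mu> ! b \<le> \<mu> ! a" if "a \<le> b" "b < length \<mu>" for a b
    using assms that by (cases "a = b") (auto simp: sorted_wrt_iff_nth_less)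
  then have "i \<in> {i. i < length \<mu> \<and> j < \<mu> ! i} \<longleftrightarrow> i < card {i. i < length \<mu> \<and> j < \<mu> ! i}"
    by (intro downward_closed_card) (auto intro: less_le_trans)
  then show ?thesis by (simp add: col_lengths_def)
qed

lemma cells_col_lengths:
  assumes "sorted_wrt (\<ge>) \<mu>"
  shows "cells (col_lengths \<mu>) = Sigma {..<length \<mu>} (\<lambda>i. {..<\<mu> ! i})"
  by (auto simp: cells_def less_col_lengths[OF assms])

lemma col_lengths_par:
  assumes \<mu>: "sorted_wrt (\<ge>) \<mu>" and "\<forall>x\<in>set \<mu>. x \<le> M"
  shows "col_lengths \<mu> \<in> par M"
proof -
  have "col_lengths \<mu> (Suc j) \<le> col_lengths \<mu> j" for j
    unfolding col_lengths_def by (intro card_mono) auto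
  moreover have "col_lengths \<mu> j = 0" if "M \<le> j" for j
  proof -
    have "\<not> j < \<mu> ! i" if "i < length \<mu>" for i
      using assms(2) nth_mem[OF that] \<open>M \<le> j\<close> by fastforce
    then show ?thesis by (auto simp: col_lengths_def)
  qed
  ultimately show ?thesis by (simp add: par_def)
qed

lemma card_cells_col_lengths:
  assumes "sorted_wrt (\<ge>) \<mu>"
  shows "card (cells (col_lengths \<mu>)) = sum_list \<mu>"
  by (simp add: cells_col_lengths[OF assms] sum_list_sum_nth atLeast0LessThan)

lemma col_lengths_par_of_size:
  assumes "\<mu> \<in> partitions N" and "\<forall>x\<in>set \<mu>. x \<le> M"
  shows "col_lengths \<mu> \<in> par_of_size M N"
  using assms col_lengths_par[of \<mu> M] card_cells[of "col_lengths \<mu>" M] card_cells_col_lengths[of \<mu>]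
  by (auto simp: partitions_def par_of_size_def)

text \<open>Conjugation. For the inverse, the first column length \<open>v 0\<close> is the number
  of rows, and row i meets column j exactly when i < v j, an initial segment of columns.\<close>

lemma col_lengths_bij:
  "bij_betw col_lengths {\<mu> \<in> partitions N. \<forall>x\<in>set \<mu>. x \<le> M} (par_of_size M N)"
proof (rule bij_betw_byWitness[where f' = "\<lambda>v. map (\<lambda>i. card {j. i < v j}) [0..<v 0]"])
  let ?rows = "\<lambda>v. map (\<lambda>i. card {j. i < v j}) [0..<v 0]"
  have card_row: "card {j. j < (x::nat)} = x" for x by simp
  show "\<forall>\<mu>\<in>{\<mu> \<in> partitions N. \<forall>x\<in>set \<mu>. x \<le> M}. ?rows (col_lengths \<mu>) = \<mu>"
  proof
    fix \<mu> assume "\<mu> \<in> {\<mu> \<in> partitions N. \<forall>x\<in>set \<mu>. x \<le> M}"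
    then have s: "sorted_wrt (\<ge>) \<mu>" and pos: "0 \<notin> set \<mu>" by (auto simp: partitions_def)
    have "{i. i < length \<mu> \<and> 0 < \<mu> ! i} = {..<length \<mu>}"
      using pos by (auto simp: in_set_conv_nth intro: gr0I)
    then have len: "col_lengths \<mu> 0 = length \<mu>" by (simp add: col_lengths_def)
    show "?rows (col_lengths \<mu>) = \<mu>"
      by (rule nth_equalityI) (simp_all add: len less_col_lengths[OF s])
  qed
  have row: "j < card {j. i < v j} \<longleftrightarrow> i < v j" if "v \<in> par M" for v i j
  proof -
    have "{j. i < v j} \<subseteq> {..<M}" using that by (auto simp: par_def not_le[symmetric])
    then have "finite {j. i < v j}" by (rule finite_subset) simp
    then have "j \<in> {j. i < v j} \<longleftrightarrow> j < card {j. i < v j}"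
      using par_antimono[OF that] by (intro downward_closed_card) (auto intro: less_le_trans)
    then show ?thesis by simp
  qed
  have cl: "col_lengths (?rows v) = v" if v: "v \<in> par M" for v
  proof
    fix j
    have "{i. i < length (?rows v) \<and> j < ?rows v ! i} = {i. i < v j}"
      using row[OF v] par_antimono[OF v, of 0 j] by (auto simp: less_le_trans)
    then show "col_lengths (?rows v) j = v j" by (simp add: col_lengths_def)
  qed
  then show "\<forall>v\<in>par_of_size M N. col_lengths (?rows v) = v" by (simp add: par_of_size_def)
  show "col_lengths ` {\<mu> \<in> partitions N. \<forall>x\<in>set \<mu>. x \<le> M} \<subseteq> par_of_size M N"
    using col_lengths_par_of_size by blast
  show "?rows ` par_of_size M N \<subseteq> {\<mu> \<in> partitions N. \<forall>x\<in>set \<mu>. x \<le> M}"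
  proof (rule image_subsetI)
    fix v assume "v \<in> par_of_size M N"
    then have v: "v \<in> par M" and N: "(\<Sum>j<M. v j) = N" by (auto simp: par_of_size_def)
    have le: "card {j. i < v j} \<le> card {j. i' < v j}" if "i' \<le> i" for i i'
    proof (rule ccontr)
      assume "\<not> ?thesis"
      then have "card {j. i' < v j} < card {j. i < v j}" by simp
      then have "i < v (card {j. i' < v j})" using row[OF v] by blast
      then have "i' < v (card {j. i' < v j})" using that by simp
      then show False using row[OF v] by blast
    qed
    have s: "sorted_wrt (\<ge>) (?rows v)" using le by (auto simp: sorted_wrt_iff_nth_less)
    have "0 < card {j. i < v j}" if "i < v 0" for i using row[OF v] that by blast
    then have pos: "0 \<notin> set (?rows v)" by (fastforce simp del: card_0_eq)
    have bd: "card {j. i < v j} \<le> M" for i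
    proof (rule ccontr)
      assume "\<not> ?thesis"
      then have "i < v M" using row[OF v] by (meson not_le)
      then show False using v by (simp add: par_def)
    qed
    have "sum_list (?rows v) = N"
      using card_cells_col_lengths[OF s] unfolding cl[OF v] by (simp add: card_cells[OF v] N)
    then show "?rows v \<in> {\<mu> \<in> partitions N. \<forall>x\<in>set \<mu>. x \<le> M}"
      using s pos bd by (auto simp: partitions_def)
  qed
qed

section \<open>Tableaux as lists of rows and as functions on cells\<close>

lemma lookup_sum_list_single:
  "Poly_Mapping.lookup (\<Sum>i\<leftarrow>xs. Poly_Mapping.single i (1::nat)) c = count_list xs c"
  by (induction xs) (auto simp: lookup_add lookup_single)

lemma count_list_card: "count_list xs c = card {j. j < length xs \<and> xs ! j = c}"
  by (simp add: count_list_eq_length_filter length_filter_conv_card eq_commute)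

lemma count_list_concat: "count_list (concat xss) c = (\<Sum>i<length xss. count_list (xss ! i) c)"
proof -
  have "count_list (concat xss) c = sum_list (map (\<lambda>xs. count_list xs c) xss)"
    by (induction xss) auto
  then show ?thesis by (simp add: sum_list_sum_nth atLeast0LessThan)
qed

definition tab_fun :: "nat list list \<Rightarrow> nat \<times> nat \<Rightarrow> nat" where
  "tab_fun T = (\<lambda>(i, j). if i < length T \<and> j < length (T ! i) then T ! i ! j else 0)"

definition tab_list :: "nat list \<Rightarrow> (nat \<times> nat \<Rightarrow> nat) \<Rightarrow> nat list list" where
  "tab_list \<mu> t = map (\<lambda>i. map (\<lambda>j. t (i, j)) [0..<\<mu> ! i]) [0..<length \<mu>]"

lemma lookup_content:
  assumes "sorted_wrt (\<ge>) \<mu>" "map length T = \<mu>"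
  shows "Poly_Mapping.lookup (content T) c = card {p \<in> cells (col_lengths \<mu>). tab_fun T p = c}"
proof -
  have len: "length T = length \<mu>" "\<And>i. i < length \<mu> \<Longrightarrow> length (T ! i) = \<mu> ! i"
    using assms(2) by auto
  have "{p \<in> cells (col_lengths \<mu>). tab_fun T p = c} =
      Sigma {..<length \<mu>} (\<lambda>i. {j. j < length (T ! i) \<and> T ! i ! j = c})"
    unfolding cells_col_lengths[OF assms(1)] by (auto simp: tab_fun_def len)
  then show ?thesis
    by (simp only: content_def lookup_sum_list_single count_list_concat len(1)) (simp add: count_list_card)
qed

text \<open>The bound \<open>L\<close> on the support of the content bounds the entries: an entry at
  or above \<open>L\<close> would be counted in the content, where its multiplicity is 0.\<close>

lemma ssyt_tableaux_bij:
  assumes \<mu>: "sorted_wrt (\<ge>) \<mu>" and supp: "\<And>c. L \<le> c \<Longrightarrow> Poly_Mapping.lookup \<alpha> c = 0"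
  shows "bij_betw tab_fun {T \<in> ssyt \<mu>. content T = \<alpha>}
    (tableaux (col_lengths \<mu>) L (Poly_Mapping.lookup \<alpha>))"
proof (rule bij_betw_byWitness[where f' = "tab_list \<mu>"])
  let ?C = "cells (col_lengths \<mu>)"
  have C: "(i, j) \<in> ?C \<longleftrightarrow> i < length \<mu> \<and> j < \<mu> ! i" for i j
    by (auto simp: cells_col_lengths[OF \<mu>])
  have finC: "finite ?C" by (simp add: cells_col_lengths[OF \<mu>])
  show "\<forall>T\<in>{T \<in> ssyt \<mu>. content T = \<alpha>}. tab_list \<mu> (tab_fun T) = T"
  proof
    fix T assume "T \<in> {T \<in> ssyt \<mu>. content T = \<alpha>}"
    then have "map length T = \<mu>" by (simp add: ssyt_def)
    then have "length T = length \<mu>" "\<And>i. i < length \<mu> \<Longrightarrow> length (T ! i) = \<mu> ! i" by auto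
    then show "tab_list \<mu> (tab_fun T) = T"
      by (auto simp: tab_list_def tab_fun_def intro!: nth_equalityI)
  qed
  have fun_list: "tab_fun (tab_list \<mu> t) = t" if "\<And>p. p \<notin> ?C \<Longrightarrow> t p = 0" for t
  proof
    fix p :: "nat \<times> nat"
    obtain i j where p: "p = (i, j)" by fastforce
    show "tab_fun (tab_list \<mu> t) p = t p"
      using that[of p] C[of i j] by (auto simp: p tab_fun_def tab_list_def)
  qed
  show "\<forall>t\<in>tableaux (col_lengths \<mu>) L (Poly_Mapping.lookup \<alpha>). tab_fun (tab_list \<mu> t) = t"
  proof
    fix t assume "t \<in> tableaux (col_lengths \<mu>) L (Poly_Mapping.lookup \<alpha>)"
    then have "\<forall>p. p \<notin> ?C \<longrightarrow> t p = 0" unfolding tableaux_def by blast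
    then show "tab_fun (tab_list \<mu> t) = t" using fun_list by blast
  qed
  show "tab_fun ` {T \<in> ssyt \<mu>. content T = \<alpha>} \<subseteq> tableaux (col_lengths \<mu>) L (Poly_Mapping.lookup \<alpha>)"
  proof (rule image_subsetI)
    fix T assume "T \<in> {T \<in> ssyt \<mu>. content T = \<alpha>}"
    then have T: "map length T = \<mu>" "\<forall>r \<in> set T. sorted r"
      "\<forall>i j. Suc i < length T \<and> j < length (T ! Suc i) \<longrightarrow> T ! i ! j < T ! Suc i ! j"
      and con: "content T = \<alpha>" by (auto simp: ssyt_def)
    have len: "length T = length \<mu>" "\<And>i. i < length \<mu> \<Longrightarrow> length (T ! i) = \<mu> ! i"
      using T(1) by auto
    have cnt: "card {p \<in> ?C. tab_fun T p = c} = Poly_Mapping.lookup \<alpha> c" for c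
      using lookup_content[OF \<mu> T(1)] con by simp
    have mono: "\<mu> ! Suc i \<le> \<mu> ! i" if "Suc i < length \<mu>" for i
      using \<mu> that by (auto simp: sorted_wrt_iff_nth_less)
    show "tab_fun T \<in> tableaux (col_lengths \<mu>) L (Poly_Mapping.lookup \<alpha>)"
      unfolding tableaux_def
    proof (intro CollectI conjI allI ballI impI)
      fix p assume "p \<notin> ?C"
      then show "tab_fun T p = 0" by (cases p) (auto simp: C tab_fun_def len)
    next
      fix p assume p: "p \<in> ?C"
      show "tab_fun T p < L"
      proof (rule ccontr)
        assume "\<not> ?thesis"
        then have "card {p' \<in> ?C. tab_fun T p' = tab_fun T p} = 0" by (simp add: cnt supp)
        then have "{p' \<in> ?C. tab_fun T p' = tab_fun T p} = {}" using finC by simp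
        then show False using p by blast
      qed
    next
      fix i j assume "(i, Suc j) \<in> ?C"
      then have ij: "i < length \<mu>" "Suc j < \<mu> ! i" by (simp_all add: C)
      have "sorted (T ! i)" using T(2) ij(1) len(1) by simp
      then show "tab_fun T (i, j) \<le> tab_fun T (i, Suc j)"
        using ij len by (simp add: tab_fun_def sorted_iff_nth_Suc)
    next
      fix i j assume "(Suc i, j) \<in> ?C"
      then have ij: "Suc i < length \<mu>" "j < \<mu> ! Suc i" by (simp_all add: C)
      then show "tab_fun T (i, j) < tab_fun T (Suc i, j)"
        using T(3) len mono[OF ij(1)] by (simp add: tab_fun_def)
    qed (rule cnt)
  qed
  show "tab_list \<mu> ` tableaux (col_lengths \<mu>) L (Poly_Mapping.lookup \<alpha>) \<subseteq> {T \<in> ssyt \<mu>. content T = \<alpha>}"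
  proof (rule image_subsetI)
    fix t assume t: "t \<in> tableaux (col_lengths \<mu>) L (Poly_Mapping.lookup \<alpha>)"
    then have t0: "\<And>p. p \<notin> ?C \<Longrightarrow> t p = 0" and tL: "\<And>p. p \<in> ?C \<Longrightarrow> t p < L"
      and row: "\<And>i j. (i, Suc j) \<in> ?C \<Longrightarrow> t (i, j) \<le> t (i, Suc j)"
      and col: "\<And>i j. (Suc i, j) \<in> ?C \<Longrightarrow> t (i, j) < t (Suc i, j)"
      and cnt: "\<And>c. c < L \<Longrightarrow> card {p \<in> ?C. t p = c} = Poly_Mapping.lookup \<alpha> c"
      unfolding tableaux_def by blast+
    let ?T = "tab_list \<mu> t"
    have len: "map length ?T = \<mu>" by (auto simp: tab_list_def intro!: nth_equalityI)
    have mono: "\<mu> ! Suc i \<le> \<mu> ! i" if "Suc i < length \<mu>" for i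
      using \<mu> that by (auto simp: sorted_wrt_iff_nth_less)
    have "sorted r" if "r \<in> set ?T" for r
      using that row by (auto simp: tab_list_def sorted_iff_nth_Suc C)
    moreover have "?T ! i ! j < ?T ! Suc i ! j" if "Suc i < length ?T" "j < length (?T ! Suc i)" for i j
      using that col[of i j] mono[of i] by (auto simp: tab_list_def C)
    ultimately have ssyt: "?T \<in> ssyt \<mu>" using len by (simp add: ssyt_def)
    have "Poly_Mapping.lookup (content ?T) c = Poly_Mapping.lookup \<alpha> c" for c
    proof -
      have "Poly_Mapping.lookup (content ?T) c = card {p \<in> ?C. t p = c}"
        using lookup_content[OF \<mu> len] fun_list[OF t0] by simp
      moreover have "{p \<in> ?C. t p = c} = {}" if "L \<le> c" using tL that by fastforce
      ultimately show ?thesis using cnt[of c] supp[of c] by (cases "c < L") auto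
    qed
    then have "content ?T = \<alpha>" by (rule poly_mapping_eqI)
    with ssyt show "?T \<in> {T \<in> ssyt \<mu>. content T = \<alpha>}" by simp
  qed
qed

lemma schur_card_tableaux:
  assumes "\<mu> \<in> partitions N" and "\<And>c. L \<le> c \<Longrightarrow> Poly_Mapping.lookup \<alpha> c = 0"
  shows "schur \<mu> \<alpha> = of_nat (card (tableaux (col_lengths \<mu>) L (Poly_Mapping.lookup \<alpha>)))"
  using bij_betw_same_card[OF ssyt_tableaux_bij[OF _ assms(2)], of \<mu>] assms(1)
  by (simp add: schur_def partitions_def)

lemma elem_spec_subsets:
  "elem_spec w M a = (\<Sum>S\<in>{S. S \<subseteq> {..<M} \<and> card S = a}. \<Prod>i\<in>S. w ^ i)"
proof -
  have m: "(\<Prod>i\<in>S. [:0, w ^ i:]) = monom (\<Prod>i\<in>S. w ^ i) (card S)" for S :: "nat set"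
  proof (induction S rule: infinite_finite_induct)
    case (insert x F)
    have "[:0, w ^ x:] = monom (w ^ x) 1" by (simp add: monom_altdef)
    then show ?case using insert by (simp add: mult_monom)
  qed auto
  have "(\<Prod>i<M. [:1, w ^ i:]) = (\<Prod>i<M. [:0, w ^ i:] + 1)" by (simp add: one_pCons)
  also have "\<dots> = (\<Sum>S\<in>Pow {..<M}. monom (\<Prod>i\<in>S. w ^ i) (card S))"
    by (subst prod_add) (simp_all add: m)
  finally have "elem_spec w M a = (\<Sum>S\<in>Pow {..<M}. if card S = a then \<Prod>i\<in>S. w ^ i else 0)"
    by (simp add: elem_spec_def coeff_sum)
  also have "\<dots> = (\<Sum>S\<in>{S \<in> Pow {..<M}. card S = a}. \<Prod>i\<in>S. w ^ i)"
    by (rule sum.inter_filter[symmetric]) simp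
  also have "{S \<in> Pow {..<M}. card S = a} = {S. S \<subseteq> {..<M} \<and> card S = a}" by auto
  finally show ?thesis .
qed

lemma q_nonzero: "q \<noteq> 0"
  by (simp add: q_def)

lemma lookup_sum_single_fst:
  assumes "finite S"
  shows "Poly_Mapping.lookup (\<Sum>a\<in>S. Poly_Mapping.single (fst a) (1::nat)) c = card {j. (c, j) \<in> S}"
proof -
  have "Poly_Mapping.lookup (\<Sum>a\<in>S. Poly_Mapping.single (fst a) (1::nat)) c = (\<Sum>a\<in>S. if fst a = c then 1 else 0)"
    by (simp add: lookup_sum lookup_single when_def del: One_nat_def)
  also have "\<dots> = card {a \<in> S. fst a = c}" using assms by (simp add: sum.inter_filter[symmetric] del: One_nat_def)
  also have "{a \<in> S. fst a = c} = Pair c ` {j. (c, j) \<in> S}" by auto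
  finally show ?thesis by (simp add: card_image inj_on_def)
qed

text \<open>A set of letters q^j x_c contributes to x^\<alpha> exactly when, for every c, it
  contains \<alpha>_c letters over x_c. These fibres are chosen independently, and each choice is
  summed by an elementary symmetric polynomial in 1, q, ..., q^(M-1).\<close>

lemma elem_sym_plethysm_prod:
  assumes supp: "\<And>c. L \<le> c \<Longrightarrow> Poly_Mapping.lookup \<alpha> c = 0"
  shows "elem_sym_plethysm N M \<alpha> =
    (if (\<Sum>c<L. Poly_Mapping.lookup \<alpha> c) = N then \<Prod>c<L. elem_spec q M (Poly_Mapping.lookup \<alpha> c) else 0)"
proof -
  let ?F = "{S. S \<subseteq> UNIV \<times> {..<M} \<and> finite S \<and> card S = N \<and>
    Poly_Mapping.lookup (\<Prod>a\<in>S. qletter a) \<alpha> \<noteq> 0}"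
  define B where "B c = {S. S \<subseteq> {..<M} \<and> card S = Poly_Mapping.lookup \<alpha> c}" for c
  define G where "G = PiE {..<L} B"
  have fib: "Poly_Mapping.lookup (\<Prod>a\<in>S. qletter a) \<alpha> =
      (if \<forall>c. card {j. (c, j) \<in> S} = Poly_Mapping.lookup \<alpha> c then \<Prod>a\<in>S. q ^ snd a else 0)"
    if "finite S" for S
    by (simp add: prod_qletter[OF that] lookup_single when_def poly_mapping_eq_iff fun_eq_iff
        lookup_sum_single_fst[OF that] del: One_nat_def)
  \<comment> \<open>Because powers of q do not vanish, the nonzero condition in
    \<open>elem_sym\<close> selects exactly the sets with the prescribed fibre sizes.\<close>
  have nz: "(\<Prod>a\<in>S. q ^ snd a) \<noteq> 0" if "finite S" for S :: "(nat \<times> nat) set"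
    using that q_nonzero by simp
  have F: "?F = {S. S \<subseteq> {..<L} \<times> {..<M} \<and> card S = N \<and>
      (\<forall>c. card {j. (c, j) \<in> S} = Poly_Mapping.lookup \<alpha> c)}" (is "_ = ?F'")
  proof (intro equalityI subsetI)
    fix S assume S: "S \<in> ?F"
    then have sub: "S \<subseteq> UNIV \<times> {..<M}" and "finite S" and N: "card S = N"
      and "Poly_Mapping.lookup (\<Prod>a\<in>S. qletter a) \<alpha> \<noteq> 0" by blast+
    then have cnt: "\<forall>c. card {j. (c, j) \<in> S} = Poly_Mapping.lookup \<alpha> c"
      by (simp only: fib split: if_splits) blast
    have "c < L" if "(c, j) \<in> S" for c j
    proof (rule ccontr)
      assume "\<not> c < L"
      then have "card {j. (c, j) \<in> S} = 0" using cnt supp by simp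
      moreover have "finite {j. (c, j) \<in> S}"
        using sub by (intro finite_subset[OF _ finite_lessThan[of M]]) auto
      ultimately have "{j. (c, j) \<in> S} = {}" by simp
      then show False using that by blast
    qed
    then have "S \<subseteq> {..<L} \<times> {..<M}" using sub by auto
    then show "S \<in> ?F'" using N cnt by blast
  next
    fix S assume S: "S \<in> ?F'"
    then have sub: "S \<subseteq> {..<L} \<times> {..<M}" and N: "card S = N"
      and cnt: "\<forall>c. card {j. (c, j) \<in> S} = Poly_Mapping.lookup \<alpha> c" by blast+
    have fin: "finite S" using finite_subset[OF sub] by blast
    have "Poly_Mapping.lookup (\<Prod>a\<in>S. qletter a) \<alpha> \<noteq> 0"
      unfolding fib[OF fin] using cnt nz[OF fin] by simp
    moreover have "S \<subseteq> UNIV \<times> {..<M}" using sub by blast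
    ultimately show "S \<in> ?F" using fin N by blast
  qed
  have card_S: "card S = (\<Sum>c<L. card {j. (c, j) \<in> S})" if "S \<subseteq> {..<L} \<times> {..<M}" for S
  proof -
    have "S = Sigma {..<L} (\<lambda>c. {j. (c, j) \<in> S})" using that by auto
    then have "card S = card (Sigma {..<L} (\<lambda>c. {j. (c, j) \<in> S}))" by (rule arg_cong)
    moreover have "finite {j. (c, j) \<in> S}" for c
      using that by (intro finite_subset[OF _ finite_lessThan[of M]]) auto
    then have "card (Sigma {..<L} (\<lambda>c. {j. (c, j) \<in> S})) = (\<Sum>c<L. card {j. (c, j) \<in> S})"
      by (intro card_SigmaI) auto
    ultimately show ?thesis by (rule trans)
  qed
  have eq: "elem_sym_plethysm N M \<alpha> = (\<Sum>S\<in>?F'. \<Prod>a\<in>S. q ^ snd a)"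
    unfolding elem_sym_plethysm_def elem_sym_def F
  proof (intro sum.cong refl)
    fix S assume S: "S \<in> ?F'"
    then have "finite S" using finite_subset[of S "{..<L} \<times> {..<M}"] by blast
    moreover have "\<forall>c. card {j. (c, j) \<in> S} = Poly_Mapping.lookup \<alpha> c" using S by blast
    ultimately show "Poly_Mapping.lookup (\<Prod>a\<in>S. qletter a) \<alpha> = (\<Prod>a\<in>S. q ^ snd a)"
      by (simp add: fib)
  qed
  show ?thesis
  proof (cases "(\<Sum>c<L. Poly_Mapping.lookup \<alpha> c) = N")
    case False
    have "card S \<noteq> N" if "S \<subseteq> {..<L} \<times> {..<M}" "\<forall>c. card {j. (c, j) \<in> S} = Poly_Mapping.lookup \<alpha> c" for S
      using card_S[OF that(1)] that(2) False by simp
    then have empty: "?F' = {}" by blast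
    show ?thesis unfolding eq empty using False by simp
  next
    case True
    have "(\<Sum>S\<in>?F'. \<Prod>a\<in>S. q ^ snd a) = (\<Sum>g\<in>G. \<Prod>c<L. \<Prod>i\<in>g c. q ^ i)"
    proof (rule sum.reindex_bij_witness[where i = "\<lambda>g. Sigma {..<L} g" and
          j = "\<lambda>S. \<lambda>c\<in>{..<L}. {j. (c, j) \<in> S}"])
      fix S assume S: "S \<in> ?F'"
      then have sub: "S \<subseteq> {..<L} \<times> {..<M}" by simp
      show e: "Sigma {..<L} (\<lambda>c\<in>{..<L}. {j. (c, j) \<in> S}) = S" using sub by auto
      show "(\<lambda>c\<in>{..<L}. {j. (c, j) \<in> S}) \<in> G" using S by (auto simp: G_def B_def)
      have "finite ((\<lambda>c\<in>{..<L}. {j. (c, j) \<in> S}) c)" if "c < L" for c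
        using sub that by (intro finite_subset[OF _ finite_lessThan[of M]]) auto
      then have "(\<Prod>c<L. \<Prod>i\<in>(\<lambda>c\<in>{..<L}. {j. (c, j) \<in> S}) c. q ^ i) =
          (\<Prod>(c, i)\<in>Sigma {..<L} (\<lambda>c\<in>{..<L}. {j. (c, j) \<in> S}). q ^ i)"
        by (intro prod.Sigma) auto
      then show "(\<Prod>c<L. \<Prod>i\<in>(\<lambda>c\<in>{..<L}. {j. (c, j) \<in> S}) c. q ^ i) = (\<Prod>a\<in>S. q ^ snd a)"
        unfolding e by (simp add: split_def)
    next
      fix g assume g: "g \<in> G"
      then have B: "g c \<subseteq> {..<M}" "card (g c) = Poly_Mapping.lookup \<alpha> c" if "c < L" for c
        using that by (auto simp: G_def B_def PiE_def Pi_def)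
      show "(\<lambda>c\<in>{..<L}. {j. (c, j) \<in> Sigma {..<L} g}) = g"
        using g by (auto simp: G_def PiE_def extensional_def fun_eq_iff)
      have sub: "Sigma {..<L} g \<subseteq> {..<L} \<times> {..<M}" using B by auto
      moreover have cnt: "card {j. (c, j) \<in> Sigma {..<L} g} = Poly_Mapping.lookup \<alpha> c" for c
        using B supp[of c] by (cases "c < L") auto
      moreover have "card (Sigma {..<L} g) = N" using card_S[OF sub] True unfolding cnt by simp
      ultimately show "Sigma {..<L} g \<in> ?F'" by blast
    qed
    also have "\<dots> = (\<Prod>c<L. \<Sum>S\<in>B c. \<Prod>i\<in>S. q ^ i)"
      unfolding G_def by (subst prod_sum_PiE) (auto simp: B_def)
    finally show ?thesis using eq True by (simp add: elem_spec_subsets B_def)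
  qed
qed

lemma to_fract_power: "to_fract (x ^ n) = to_fract x ^ n"
  by (induction n) simp_all

lemma schur_spec_q: "schur_spec q M l = to_fract (schur_spec pX M l)"
  by (induction M arbitrary: l) (simp_all add: to_fract_power q_def del: mult_pCons_left)

lemma q_int_q_num: "q_int s = to_fract (q_num s)"
  by (simp add: q_int_def q_num_def q_def to_fract_power)

lemma q_num_nonzero: "0 < s \<Longrightarrow> q_num s \<noteq> 0"
  using q_num_add[of 1 "s - 1"] by (auto simp: q_num_def dest: arg_cong[where f = "\<lambda>p. coeff p 0"])

text \<open>Coefficientwise dual Cauchy identity, with \<open>L\<close> chosen beyond the support of
  \<alpha>. If \<alpha> does not have degree \<open>N\<close>, both sides vanish, since no tableau
  of size \<open>N\<close> has this content.\<close>

lemma elem_sym_plethysm_schur: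
  "elem_sym_plethysm N M \<alpha> =
    (\<Sum>\<mu> | \<mu> \<in> partitions N \<and> (\<forall>x\<in>set \<mu>. x \<le> M). to_fract (schur_spec pX M (col_lengths \<mu>)) * schur \<mu> \<alpha>)"
proof -
  let ?P = "{\<mu> \<in> partitions N. \<forall>x\<in>set \<mu>. x \<le> M}"
  obtain L where "Poly_Mapping.keys \<alpha> \<subseteq> {..<L}"
    using finite_nat_iff_bounded[of "Poly_Mapping.keys \<alpha>"] by auto
  then have supp: "\<And>c. L \<le> c \<Longrightarrow> Poly_Mapping.lookup \<alpha> c = 0"
    by (metis in_keys_iff lessThan_iff not_le subsetD)
  let ?a = "Poly_Mapping.lookup \<alpha>"
  have "elem_sym_plethysm N M \<alpha> =
      (\<Sum>v\<in>par_of_size M N. of_nat (card (tableaux v L ?a)) * schur_spec q M v)"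
  proof (cases "(\<Sum>c<L. ?a c) = N")
    case True
    then show ?thesis using elem_sym_plethysm_prod[of L \<alpha>, OF supp] elem_spec_prod[of q M ?a L] by simp
  next
    case False
    then have "tableaux v L ?a = {}" if "v \<in> par_of_size M N" for v
      using that tableaux_size[of v M _ L ?a] by (auto simp: par_of_size_def)
    then show ?thesis using False elem_sym_plethysm_prod[of L \<alpha>, OF supp] by simp
  qed
  also have "\<dots> = (\<Sum>\<mu>\<in>?P. of_nat (card (tableaux (col_lengths \<mu>) L ?a)) * schur_spec q M (col_lengths \<mu>))"
    by (rule sum.reindex_bij_betw[OF col_lengths_bij, symmetric])
  also have "\<dots> = (\<Sum>\<mu>\<in>?P. to_fract (schur_spec pX M (col_lengths \<mu>)) * schur \<mu> \<alpha>)"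
    by (intro sum.cong refl) (auto simp: schur_card_tableaux[OF _ supp] schur_spec_q mult.commute)
  finally show ?thesis .
qed

theorem theorem2p1:
  fixes m n k :: nat
  assumes "m > 0" and "n > 0" and "coprime m n" and "k \<ge> 1"
  shows "schur_positive (k * n)
    (\<lambda>\<alpha>. q_int k / q_int (k * m) * elem_sym_plethysm (k * n) (k * m) \<alpha>)"
proof -
  define M N where "M = k * m" and "N = k * n"
  have M: "0 < M" using assms by (simp add: M_def)
  \<comment> \<open>Coprimality enters here: it makes the gcd supplied by the divisibility argument
    equal to k.\<close>
  have gcd: "gcd M N = k" using assms(3) by (simp add: M_def N_def gcd_mult_distrib_nat[symmetric])
  have "\<exists>p. q_num k * schur_spec pX M v = q_num M * p \<and> (\<forall>i. 0 \<le> coeff p i)" if "v \<in> par_of_size M N" for v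
    using schur_spec_quotient[OF M, of v] that gcd by (auto simp: par_of_size_def)
  then obtain P where P: "\<And>v. v \<in> par_of_size M N \<Longrightarrow> q_num k * schur_spec pX M v = q_num M * P v"
    "\<And>v i. v \<in> par_of_size M N \<Longrightarrow> 0 \<le> coeff (P v) i" by metis
  \<comment> \<open>A shape with a part above M has a conjugate with more than M rows, whose Schur
    polynomial in M letters is 0. Accordingly its coefficient is set to 0.\<close>
  define c where "c \<mu> = (if \<forall>x\<in>set \<mu>. x \<le> M then P (col_lengths \<mu>) else 0)" for \<mu>
  have "0 \<le> coeff (c \<mu>) i" if "\<mu> \<in> partitions N" for \<mu> i
    using P(2) col_lengths_par_of_size[OF that] by (simp add: c_def)
  moreover have "q_int k / q_int M * elem_sym_plethysm N M \<alpha> =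
      (\<Sum>\<mu>\<in>partitions N. to_fract (c \<mu>) * schur \<mu> \<alpha>)" for \<alpha>
  proof -
    have "q_int k / q_int M * elem_sym_plethysm N M \<alpha> =
        (\<Sum>\<mu> | \<mu> \<in> partitions N \<and> (\<forall>x\<in>set \<mu>. x \<le> M). to_fract (c \<mu>) * schur \<mu> \<alpha>)"
      unfolding elem_sym_plethysm_schur sum_distrib_left
    proof (intro sum.cong refl, clarify)
      fix \<mu> assume \<mu>: "\<mu> \<in> partitions N" "\<forall>x\<in>set \<mu>. x \<le> M"
      have "q_int k * to_fract (schur_spec pX M (col_lengths \<mu>)) = q_int M * to_fract (c \<mu>)"
        using P(1)[OF col_lengths_par_of_size[OF \<mu>]] \<mu>(2)
        by (simp only: q_int_q_num to_fract_mult[symmetric] c_def) simp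
      moreover have "q_int M \<noteq> 0" using q_num_nonzero[OF M] by (simp add: q_int_q_num)
      ultimately have "q_int k / q_int M * to_fract (schur_spec pX M (col_lengths \<mu>)) = to_fract (c \<mu>)"
        by (simp add: field_simps)
      then show "q_int k / q_int M * (to_fract (schur_spec pX M (col_lengths \<mu>)) * schur \<mu> \<alpha>) =
          to_fract (c \<mu>) * schur \<mu> \<alpha>"
        by (simp only: mult.assoc[symmetric])
    qed
    also have "\<dots> = (\<Sum>\<mu>\<in>partitions N. to_fract (c \<mu>) * schur \<mu> \<alpha>)"
      using finite_partitions by (intro sum.mono_neutral_left) (auto simp: c_def)
    finally show ?thesis .
  qed
  ultimately show ?thesis unfolding schur_positive_def M_def[symmetric] N_def[symmetric] by blast
qed

end
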